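(* Let $c>1$, $\alpha\in(0,2)$, let $\theta_1,\theta_2$ be admissable functions with respect to $c$ and $\alpha$, and let $v,D_1,D_2\in\mathbb{R}$ with $D_1+D_2\neq0$ and with $D_1,D_2\le0$ if $\alpha\in(0,1)$, respectively $D_1,D_2\ge0$ if $\alpha\in[1,2)$. Let $(X_t)_{t\ge0}$ be the semistable Lévy process given uniquely in law by the semistable distribution $\nu$ of $X_1$ whose log-characteristic function is $$\psi(x)=iax+\int_{\mathbb{R}\setminus\{0\}}\left(e^{ixy}-1-\frac{ixy}{1+y^2}\right)d\phi(y)$$ with Lévy measure $\phi$ given for all $r>0$ by $$\phi(r,\infty)=r^{-\alpha}|D_1|\theta_1(\log r),\qquad \phi(-\infty,-r)=r^{-\alpha}|D_2|\theta_2(\log r),$$ and drift $$a=v+\begin{cases}\displaystyle\int_{\mathbb{R}\setminus\{0\}}\frac{y}{1+y^2}\,d\phi(y)&\text{if }\alpha\in(0,1),\\[2ex]\displaystyle\int_{\mathbb{R}\setminus\{0\}}\left(\frac{y}{1+y^2}-\sin y\right)d\phi(y)&\text{if }\alpha=1,\\[2ex]\displaystyle\int_{\mathbb{R}\setminus\{0\}}\left(\frac{y}{1+y^2}-y\right)d\phi(y)&\text{if }\alpha\in(1,2).\end{cases}$$ Then $X_t$ has a continuous Lebesgue density $x\mapsto p(x,t)$ for every $t>0$, and these densities are a solution to the semi-fractional diffusion equation $$\frac{\partial}{\partial t}p(x,t)=-v\frac{\partial}{\partial x}p(x,t)+D_1\frac{\partial^\alpha}{\partial_{c,\theta_1}x^\alpha}p(x,t)+D_2\frac{\partial^\alpha}{\partial_{c,\theta_2}(-x)^\alpha}p(x,t),\qquad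 x\in\mathbb{R},\ t>0.$$
   Context: Given $c>1$ and $\alpha\in(0,2)$, a function $\theta:\mathbb{R}\to(0,\infty)$ is called admissable (with respect to $c$ and $\alpha$) if it is $\log(c^{1/\alpha})$-periodic and satisfies $\theta(y+\delta)\le e^{\alpha\delta}\theta(y)$ for all $y\in\mathbb{R}$, $\delta\ge 0$. The log-characteristic function $\psi$ is normalized by $\mathbb{E}[\exp(ixX_t)]=\exp(t\psi(x))$. For an admissable $\theta$ let $\phi_\theta$ be the measure on $(0,\infty)$ with $\phi_\theta(r,\infty)=r^{-\alpha}\theta(\log r)$ for all $r>0$. The positive and negative semi-fractional derivatives of order $\alpha$ with respect to $c,\theta$ are defined as follows. For $\alpha\in(0,1)$: $$\frac{\partial^{\alpha}}{\partial_{c,\theta}x^{\alpha}}f(x)=\int_{0+}^\infty(f(x)-f(x-y))\,d\phi_\theta(y),\qquad \frac{\partial^{\alpha}}{\partial_{c,\theta}(-x)^{\alpha}}f(x)=\int_{0+}^\infty(f(x)-f(x+y))\,d\phi_\theta(y).$$ For $\alpha\in(1,2)$: $$\frac{\partial^{\alpha}}{\partial_{c,\theta}x^{\alpha}}f(x)=\int_{0+}^\infty(f(x-y)-f(x)+yf'(x))\,d\phi_\theta(y),\qquad \frac{\partial^{\alpha}}{\partial_{c,\theta}(-x)^{\alpha}}f(x)=\int_{0+}^\infty(f(x+y)-f(x)-yf'(x))\,d\phi_\theta(y).$$ For $\alpha=1$ (Zolotarev form): $$\frac{\partial^1}{\partial_{c,\theta}x^1}f(x)=\int_{0+}^\infty(f(x-y)-f(x)+f'(x)\sin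 y)\,d\phi_\theta(y),\qquad \frac{\partial^1}{\partial_{c,\theta}(-x)^1}f(x)=\int_{0+}^\infty(f(x+y)-f(x)-f'(x)\sin y)\,d\phi_\theta(y).$$ In the equation these operators act on the variable $x$. *)

theory Defs
  imports "HOL-Probability.Probability"
begin

definition admissable :: "real \<Rightarrow> real \<Rightarrow> (real \<Rightarrow> real) \<Rightarrow> bool" where
  "admissable c \<alpha> \<theta> \<longleftrightarrow>
     (\<forall>y. \<theta> y > 0) \<and>
     (\<forall>y. \<theta> (y + ln (c powr (1 / \<alpha>))) = \<theta> y) \<and>
     (\<forall>y \<delta>. \<delta> \<ge> 0 \<longrightarrow> \<theta> (y + \<delta>) \<le> exp (\<alpha> * \<delta>) * \<theta> y)"

text \<open>A measure on \<open>(0,\<infinity>)\<close> is encoded as a Borel measure on the real line that is null on \<open>(-\<infinity>,0]\<close>.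
  There is at most one measure with the tails prescribed below. Its existence requires
  \<open>r \<mapsto> r\<^sup>-\<^sup>\<alpha> \<theta>(log r)\<close> to be right-continuous, which admissability of \<open>\<theta>\<close> alone does not imply.\<close>

definition is_phi_measure :: "real \<Rightarrow> (real \<Rightarrow> real) \<Rightarrow> real measure \<Rightarrow> bool" where
  "is_phi_measure \<alpha> \<theta> \<mu> \<longleftrightarrow>
     sets \<mu> = sets borel \<and> emeasure \<mu> {..0} = 0 \<and>
     (\<forall>r>0. emeasure \<mu> {r<..} = ennreal (r powr (- \<alpha>) * \<theta> (ln r)))"

definition phi_measure :: "real \<Rightarrow> (real \<Rightarrow> real) \<Rightarrow> real measure" where
  "phi_measure \<alpha> \<theta> = (THE \<mu>. is_phi_measure \<alpha> \<theta> \<mu>)"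

text \<open>The period parameter \<open>c\<close> enters the semi-fractional derivatives only through the
  admissability of \<open>\<theta>\<close>, hence it is not an argument of the operators. The predicates
  \<open>has_semifrac_pos\<close> and \<open>has_semifrac_neg\<close> say that the defining integral converges (absolutely),
  which the value alone does not show, since a divergent Bochner integral is \<open>0\<close>.\<close>

definition semifrac_integrand_pos :: "real \<Rightarrow> (real \<Rightarrow> real) \<Rightarrow> real \<Rightarrow> real \<Rightarrow> real" where
  "semifrac_integrand_pos \<alpha> f x y =
     (if \<alpha> < 1 then f x - f (x - y)
      else if \<alpha> = 1 then f (x - y) - f x + deriv f x * sin y
      else f (x - y) - f x + y * deriv f x)"

definition semifrac_integrand_neg :: "real \<Rightarrow> (real \<Rightarrow> real) \<Rightarrow> real \<Rightarrow> real \<Rightarrow> real" where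
  "semifrac_integrand_neg \<alpha> f x y =
     (if \<alpha> < 1 then f x - f (x + y)
      else if \<alpha> = 1 then f (x + y) - f x - deriv f x * sin y
      else f (x + y) - f x - y * deriv f x)"

definition has_semifrac_pos :: "real \<Rightarrow> (real \<Rightarrow> real) \<Rightarrow> (real \<Rightarrow> real) \<Rightarrow> real \<Rightarrow> bool" where
  "has_semifrac_pos \<alpha> \<theta> f x \<longleftrightarrow>
     (\<alpha> \<ge> 1 \<longrightarrow> f differentiable (at x)) \<and>
     set_integrable (phi_measure \<alpha> \<theta>) {0<..} (semifrac_integrand_pos \<alpha> f x)"

definition has_semifrac_neg :: "real \<Rightarrow> (real \<Rightarrow> real) \<Rightarrow> (real \<Rightarrow> real) \<Rightarrow> real \<Rightarrow> bool" where
  "has_semifrac_neg \<alpha> \<theta> f x \<longleftrightarrow>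
     (\<alpha> \<ge> 1 \<longrightarrow> f differentiable (at x)) \<and>
     set_integrable (phi_measure \<alpha> \<theta>) {0<..} (semifrac_integrand_neg \<alpha> f x)"

definition semifrac_pos :: "real \<Rightarrow> (real \<Rightarrow> real) \<Rightarrow> (real \<Rightarrow> real) \<Rightarrow> real \<Rightarrow> real" where
  "semifrac_pos \<alpha> \<theta> f x =
     (LINT y:{0<..}|phi_measure \<alpha> \<theta>. semifrac_integrand_pos \<alpha> f x y)"

definition semifrac_neg :: "real \<Rightarrow> (real \<Rightarrow> real) \<Rightarrow> (real \<Rightarrow> real) \<Rightarrow> real \<Rightarrow> real" where
  "semifrac_neg \<alpha> \<theta> f x =
     (LINT y:{0<..}|phi_measure \<alpha> \<theta>. semifrac_integrand_neg \<alpha> f x y)"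

text \<open>Path regularity is not part of the definition: only the law of the process matters here,
  and every process as below has a version with right-continuous paths and left limits.\<close>

definition levy_process :: "'a measure \<Rightarrow> (real \<Rightarrow> 'a \<Rightarrow> real) \<Rightarrow> bool" where
  "levy_process M X \<longleftrightarrow>
     prob_space M \<and>
     (\<forall>t\<ge>0. X t \<in> borel_measurable M) \<and>
     (AE \<omega> in M. X 0 \<omega> = 0) \<and>
     (\<forall>(n::nat) (\<tau>::nat \<Rightarrow> real). 0 \<le> \<tau> 0 \<and> mono \<tau> \<longrightarrow>
        prob_space.indep_vars M (\<lambda>_. borel) (\<lambda>i \<omega>. X (\<tau> (Suc i)) \<omega> - X (\<tau> i) \<omega>) {..<n}) \<and>
     (\<forall>s\<ge>0. \<forall>t\<ge>0. distr M borel (\<lambda>\<omega>. X (s + t) \<omega> - X s \<omega>) = distr M borel (X t)) \<and>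
     (\<forall>s\<ge>0. \<forall>\<epsilon>>0.
        ((\<lambda>t. measure M {\<omega> \<in> space M. \<bar>X t \<omega> - X s \<omega>\<bar> > \<epsilon>}) \<longlongrightarrow> 0) (at s within {0..}))"

text \<open>Semistability of \<open>\<nu> = P\<^bsub>X\<^sub>1\<^esub>\<close>, i.e. \<open>\<nu>\<^sup>c = (c\<^bsup>1/\<alpha>\<^esup> \<nu>) * \<epsilon>\<^sub>d\<close> for some \<open>d\<close>; the
  convolution power \<open>\<nu>\<^sup>c\<close> with real exponent is the law of \<open>X\<^sub>c\<close>.\<close>

definition semistable_levy_process ::
    "real \<Rightarrow> real \<Rightarrow> 'a measure \<Rightarrow> (real \<Rightarrow> 'a \<Rightarrow> real) \<Rightarrow> bool" where
  "semistable_levy_process c \<alpha> M X \<longleftrightarrow>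
     levy_process M X \<and>
     (\<exists>d. distr M borel (X c) = distr M borel (\<lambda>\<omega>. c powr (1 / \<alpha>) * X 1 \<omega> + d))"

definition levy_measure :: "real measure \<Rightarrow> bool" where
  "levy_measure \<phi> \<longleftrightarrow>
     sets \<phi> = sets borel \<and> emeasure \<phi> {0} = 0 \<and>
     (\<integral>\<^sup>+ y. ennreal (min 1 (y\<^sup>2)) \<partial>\<phi>) < \<infinity>"

definition log_char :: "real \<Rightarrow> real measure \<Rightarrow> real \<Rightarrow> complex" where
  "log_char a \<phi> x =
     \<i> * complex_of_real (a * x) +
     (LINT y:- {0}|\<phi>. iexp (x * y) - 1 - \<i> * complex_of_real (x * y / (1 + y\<^sup>2)))"

end

theory Submission
  imports Defs
begin

text \<open>The law of \<open>X t\<close> has characteristic function \<open>exp (t \<psi>)\<close>. Since \<open>\<theta>\<close> has equal values at the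
  two ends of a period, the Levy measure puts mass of order \<open>\<bar>k\<bar> powr \<alpha>\<close> on the jumps of size about
  \<open>1 / \<bar>k\<bar>\<close>, so \<open>Re \<psi> k \<le> - C * \<bar>k\<bar> powr \<alpha>\<close>. Hence \<open>exp (t \<psi>)\<close> is integrable against every polynomial,
  and Fourier inversion gives a density \<open>p\<close> that can be differentiated under the integral sign, with
  \<open>\<partial>\<^sub>t p\<close> the inverse transform of \<open>\<psi> exp (t \<psi>)\<close>. The drift is chosen such that \<open>\<psi> k = \<i> v k\<close> plus integrals of
  a kernel \<open>exp (\<i> k y) - 1 - \<i> k \<kappa> y\<close>, where \<open>\<kappa>\<close> is the compensator \<open>0\<close>, \<open>sin\<close> or the identity
  that occurs in the semi-fractional derivatives. By Fubini, these are the Fourier multipliers of the operators on the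
  right-hand side.\<close>

section \<open>Measures on the half-line with prescribed tails\<close>

text \<open>The measures \<open>phi_measure\<close> have infinite mass near 0 and are known only
  through their tails. Hence the estimates rest on one inequality with separated variables: the
  compensated kernel is at most 3 (1 + k^2) times a function of y alone, which tails of order
  r^(-\<alpha>) can integrate. This one bound yields continuity and quadratic growth of the symbol,
  and it justifies Fubini and the derivative in t; the factor 1 + k^2 is absorbed by the decay of
  exp (t \<psi>). Two further obstacles are less visible. The characteristic function is prescribed
  at time 1 only, so its logarithm at other times has to be pinned down by continuity in the
  frequency. And Levy's inversion formula speaks of intervals whose end points carry no mass, while
  the absence of atoms is part of what is to be shown; therefore the distribution function is first
  shown to be differentiable everywhere, and the density is read off from its derivative.\<close>

lemma emeasure_eq_of_tails:
  fixes \<mu> \<nu> :: "real measure"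
  assumes [measurable_cong]: "sets \<mu> = sets borel" "sets \<nu> = sets borel"
    and eq: "\<And>r. r > 0 \<Longrightarrow> emeasure \<mu> {r<..} = emeasure \<nu> {r<..}"
    and fin: "\<And>r. r > 0 \<Longrightarrow> emeasure \<mu> {r<..} < \<infinity>"
    and A: "A \<in> sets borel" "A \<subseteq> {0<..}"
  shows "emeasure \<mu> A = emeasure \<nu> A"
proof -
  have ind: "emeasure (density M (indicator {s<..})) B = emeasure M (B \<inter> {s<..})"
    if "sets M = sets borel" "B \<in> sets borel" for M B and s :: real
    using that by (subst emeasure_density) (auto simp: indicator_inter_arith[symmetric] mult.commute)
  \<comment> \<open>Beyond any s > 0 both measures are finite, so there the tails determine them;
    the total masses near 0 may be infinite.\<close>
  have dens: "density \<mu> (indicator {s<..}) = density \<nu> (indicator {s<..})" if "s > 0" for s :: real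
  proof (rule measure_eqI_lessThan)
    have *: "{x<..} \<inter> {s<..} = {max x s<..}" for x by auto
    show "emeasure (density \<mu> (indicator {s<..})) {x<..} < \<infinity>" for x
      using fin[of "max x s"] that by (subst ind) (auto simp: assms *)
    show "emeasure (density \<mu> (indicator {s<..})) {x<..} = emeasure (density \<nu> (indicator {s<..})) {x<..}" for x
      using eq[of "max x s"] that by (subst (1 2) ind) (auto simp: assms *)
  qed (auto simp: assms)
  let ?s = "\<lambda>n. 1 / real (Suc n)"
  let ?B = "\<lambda>n. A \<inter> {?s n<..}"
  have un: "(\<Union>n. ?B n) = A"
    using A(2) reals_Archimedean by (force simp: inverse_eq_divide[symmetric] simp del: of_nat_Suc)
  have Bm: "range ?B \<subseteq> sets borel" using A(1) by auto
  have inc: "incseq ?B"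
  proof (intro incseq_SucI Int_mono subset_refl)
    show "{?s n<..} \<subseteq> {?s (Suc n)<..}" for n
      using frac_le[of 1 1 "real (Suc n)" "real (Suc (Suc n))"] by (auto simp del: of_nat_Suc)
  qed
  have "emeasure \<mu> (?B n) = emeasure \<nu> (?B n)" for n
    using dens[of "?s n"] A ind[of \<mu> A "?s n"] ind[of \<nu> A "?s n"] by (auto simp: assms)
  then have "(SUP n. emeasure \<mu> (?B n)) = (SUP n. emeasure \<nu> (?B n))" by simp
  moreover have "(SUP n. emeasure \<mu> (?B n)) = emeasure \<mu> A" "(SUP n. emeasure \<nu> (?B n)) = emeasure \<nu> A"
    using SUP_emeasure_incseq[of ?B \<mu>] SUP_emeasure_incseq[of ?B \<nu>] inc Bm un by (simp_all add: assms)
  ultimately show ?thesis by simp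
qed

text \<open>This makes the definite description in \<open>phi_measure\<close> meaningful as soon as
  some measure with these tails exists. The tails decide on the positive half-line, and the other
  half is null by definition.\<close>

lemma is_phi_measure_unique:
  assumes "is_phi_measure \<alpha> \<theta> \<mu>" "is_phi_measure \<alpha> \<theta> \<nu>"
  shows "\<mu> = \<nu>"
proof (rule measure_eqI)
  have s: "sets \<mu> = sets borel" "sets \<nu> = sets borel" using assms by (auto simp: is_phi_measure_def)
  show "sets \<mu> = sets \<nu>" using s by simp
  fix A assume "A \<in> sets \<mu>"
  then have A: "A \<in> sets borel" using s by simp
  have e: "emeasure M A = emeasure M (A \<inter> {0<..})" if "is_phi_measure \<alpha> \<theta> M" for M
  proof -
    have s: "sets M = sets borel" and 0: "emeasure M {..0} = 0" using that by (auto simp: is_phi_measure_def)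
    have "{..0} \<in> null_sets M" using s 0 by (auto simp: null_sets_def)
    then have "AE x in M. x \<notin> {..0}" by (rule AE_not_in)
    then show ?thesis by (intro emeasure_eq_AE) (use A s in auto)
  qed
  have "emeasure \<mu> (A \<inter> {0<..}) = emeasure \<nu> (A \<inter> {0<..})"
    by (rule emeasure_eq_of_tails[OF s]) (use assms A in \<open>auto simp: is_phi_measure_def\<close>)
  with e[OF assms(1)] e[OF assms(2)] show "emeasure \<mu> A = emeasure \<nu> A" by simp
qed

lemma is_phi_measure_phi_measure:
  assumes "\<exists>\<mu>. is_phi_measure \<alpha> \<theta> \<mu>"
  shows "is_phi_measure \<alpha> \<theta> (phi_measure \<alpha> \<theta>)"
  unfolding phi_measure_def by (rule theI') (use assms is_phi_measure_unique in blast)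

lemma is_phi_measureD:
  assumes "is_phi_measure \<alpha> \<theta> \<mu>"
  shows "sets \<mu> = sets borel" "emeasure \<mu> {..0} = 0"
    "\<And>r. r > 0 \<Longrightarrow> emeasure \<mu> {r<..} = ennreal (r powr (- \<alpha>) * \<theta> (ln r))"
  using assms by (auto simp: is_phi_measure_def)

text \<open>A prerequisite of Fubini's theorem: countably many tails of finite mass exhaust the
  positive half-line.\<close>

lemma sigma_finite_is_phi_measure:
  assumes "is_phi_measure \<alpha> \<theta> \<mu>"
  shows "sigma_finite_measure \<mu>"
proof
  note D = is_phi_measureD[OF assms]
  let ?A = "insert {..0::real} (range (\<lambda>n. {1 / real (Suc n)<..}))"
  have "\<exists>n. 1 / real (Suc n) < x" if "\<not> x \<le> 0" for x :: real
    using reals_Archimedean[of x] that by (auto simp: inverse_eq_divide)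
  then have "\<Union>?A = space \<mu>"
    using sets_eq_imp_space_eq[OF D(1)] by (auto simp del: of_nat_Suc)
  then show "\<exists>A. countable A \<and> A \<subseteq> sets \<mu> \<and> \<Union>A = space \<mu> \<and> (\<forall>a\<in>A. emeasure \<mu> a \<noteq> \<infinity>)"
    using D by (intro exI[of _ ?A]) (auto simp del: of_nat_Suc)
qed

text \<open>The growth condition only controls moves to the right, but periodicity turns any move
  into one to the right by at most a period P. Since \<alpha> P = ln c, any two values of \<theta>
  differ at most by the factor c. No continuity of \<theta> enters.\<close>

lemma admissable_bounds:
  assumes c: "c > 1" and \<alpha>: "\<alpha> > 0" and ad: "admissable c \<alpha> \<theta>"
  obtains m K where "m > 0" "\<And>y. m \<le> \<theta> y" "\<And>y. \<theta> y \<le> K"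
proof -
  define P where "P = ln (c powr (1 / \<alpha>))"
  have P: "P > 0" "\<alpha> * P = ln c" using c \<alpha> by (auto simp: P_def ln_powr)
  have per: "\<theta> (y + P) = \<theta> y" and pos: "\<theta> y > 0"
    and gr: "\<delta> \<ge> 0 \<Longrightarrow> \<theta> (y + \<delta>) \<le> exp (\<alpha> * \<delta>) * \<theta> y" for y \<delta>
    using ad by (auto simp: admissable_def P_def)
  have pern: "\<theta> (y + real n * P) = \<theta> y" for y n
  proof (induction n)
    case (Suc n)
    have "\<theta> (y + real (Suc n) * P) = \<theta> ((y + real n * P) + P)" by (simp add: algebra_simps)
    with Suc per show ?case by simp
  qed simp
  have peri: "\<theta> (y + of_int i * P) = \<theta> y" for y i
  proof (cases "i \<ge> 0")
    case True
    then show ?thesis using pern[of y "nat i"] by simp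
  next
    case False
    then show ?thesis using pern[of "y + of_int i * P" "nat (- i)"] by simp
  qed
  have cmp: "\<theta> x \<le> c * \<theta> y" for x y
  proof -
    define i where "i = \<lfloor>(x - y) / P\<rfloor>"
    define \<delta> where "\<delta> = (x - y) - of_int i * P"
    have "of_int i \<le> (x - y) / P" "(x - y) / P < of_int i + 1" unfolding i_def by linarith+
    then have d: "0 \<le> \<delta>" "\<delta> \<le> P" using P by (auto simp: \<delta>_def field_simps)
    have "\<theta> x = \<theta> (y + \<delta> + of_int i * P)" by (simp add: \<delta>_def)
    also have "\<dots> = \<theta> (y + \<delta>)" by (rule peri)
    also have "\<dots> \<le> exp (\<alpha> * \<delta>) * \<theta> y" by (rule gr) (use d in auto)
    also have "\<dots> \<le> exp (\<alpha> * P) * \<theta> y" using d \<alpha> pos[of y] by (intro mult_right_mono) auto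
    finally show ?thesis using P c by simp
  qed
  show thesis
  proof (rule that[of "\<theta> 0 / c" "c * \<theta> 0"])
    show "\<theta> 0 / c \<le> \<theta> y" for y using cmp[of 0 y] c by (simp add: field_simps)
  qed (use cmp c pos in auto)
qed

text \<open>Proportional tails force proportional measures on the positive half-line, so integrals
  transfer through a common density. The factor d may be 0, as happens when one of
  \<open>D1\<close>, \<open>D2\<close> vanishes.\<close>

lemma set_integral_of_tails:
  fixes F :: "real \<Rightarrow> 'b::{banach, second_countable_topology}"
  assumes s: "sets \<phi> = sets borel" "sets \<mu> = sets borel" and d: "d \<ge> 0"
    and eq: "\<And>r. r > 0 \<Longrightarrow> emeasure \<phi> {r<..} = ennreal d * emeasure \<mu> {r<..}"
    and fin: "\<And>r. r > 0 \<Longrightarrow> emeasure \<mu> {r<..} < \<infinity>"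
    and F[measurable]: "F \<in> borel_measurable borel" and int: "set_integrable \<mu> {0<..} F"
  shows "set_integrable \<phi> {0<..} F"
    and "(LINT y:{0<..}|\<phi>. F y) = d *\<^sub>R (LINT y:{0<..}|\<mu>. F y)"
proof -
  note [measurable_cong] = s
  have Fm: "F \<in> borel_measurable \<phi>" "F \<in> borel_measurable \<mu>" by measurable
  have dens: "density \<phi> (\<lambda>y. ennreal (indicator {0<..} y)) = density \<mu> (\<lambda>y. ennreal (d * indicator {0<..} y))"
  proof (rule measure_eqI)
    fix A assume "A \<in> sets (density \<phi> (\<lambda>y. ennreal (indicator {0<..} y)))"
    then have A[measurable]: "A \<in> sets borel" using s by simp
    have de: "emeasure (density \<mu> (\<lambda>_. ennreal d)) B = ennreal d * emeasure \<mu> B" if "B \<in> sets borel" for B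
      using that s by (subst emeasure_density_const) auto
    have "emeasure (density \<phi> (\<lambda>y. ennreal (indicator {0<..} y))) A = emeasure \<phi> (A \<inter> {0<..})"
      using s by (subst emeasure_density)
        (auto simp: indicator_inter_arith ac_simps ennreal_indicator simp flip: nn_integral_indicator)
    also have "\<dots> = emeasure (density \<mu> (\<lambda>_. ennreal d)) (A \<inter> {0<..})"
      by (rule emeasure_eq_of_tails) (use eq fin in \<open>auto simp: s de ennreal_mult_less_top\<close>)
    also have "\<dots> = ennreal d * emeasure \<mu> (A \<inter> {0<..})" by (rule de) auto
    also have "\<dots> = (\<integral>\<^sup>+y. ennreal d * indicator (A \<inter> {0<..}) y \<partial>\<mu>)"
      using s by (subst nn_integral_cmult_indicator) auto
    also have "\<dots> = emeasure (density \<mu> (\<lambda>y. ennreal (d * indicator {0<..} y))) A"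
      using s by (subst emeasure_density) (auto intro!: nn_integral_cong split: split_indicator)
    finally show "emeasure (density \<phi> (\<lambda>y. ennreal (indicator {0<..} y))) A =
      emeasure (density \<mu> (\<lambda>y. ennreal (d * indicator {0<..} y))) A" .
  qed (simp add: s)
  have "integrable (density \<mu> (\<lambda>y. ennreal (d * indicator {0<..} y))) F"
    using int d Fm by (subst integrable_density) (auto simp: set_integrable_def simp flip: scaleR_scaleR)
  then have "integrable (density \<phi> (\<lambda>y. ennreal (indicator {0<..} y))) F" by (simp add: dens)
  then show "set_integrable \<phi> {0<..} F" using Fm
    by (subst (asm) integrable_density) (auto simp: set_integrable_def)
  have "(LINT y:{0<..}|\<phi>. F y) = integral\<^sup>L (density \<phi> (\<lambda>y. ennreal (indicator {0<..} y))) F"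
    using Fm by (subst integral_density) (auto simp: set_lebesgue_integral_def)
  also have "\<dots> = integral\<^sup>L (density \<mu> (\<lambda>y. ennreal (d * indicator {0<..} y))) F" by (simp add: dens)
  also have "\<dots> = d *\<^sub>R (LINT y:{0<..}|\<mu>. F y)"
    using d Fm by (subst integral_density) (auto simp: set_lebesgue_integral_def simp flip: scaleR_scaleR)
  finally show "(LINT y:{0<..}|\<phi>. F y) = d *\<^sub>R (LINT y:{0<..}|\<mu>. F y)" .
qed

lemma set_integral_minus_zero_split:
  fixes F :: "real \<Rightarrow> 'b::{banach, second_countable_topology}"
  assumes s: "sets \<phi> = sets borel" "sets \<mu> = sets borel" "sets \<nu> = sets borel"
    and d: "d \<ge> 0" "e \<ge> 0"
    and pos: "\<And>r. r > 0 \<Longrightarrow> emeasure \<phi> {r<..} = ennreal d * emeasure \<mu> {r<..}"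
    and neg: "\<And>r. r > 0 \<Longrightarrow> emeasure \<phi> {..<- r} = ennreal e * emeasure \<nu> {r<..}"
    and fin: "\<And>r. r > 0 \<Longrightarrow> emeasure \<mu> {r<..} < \<infinity>" "\<And>r. r > 0 \<Longrightarrow> emeasure \<nu> {r<..} < \<infinity>"
    and F[measurable]: "F \<in> borel_measurable borel"
    and int: "set_integrable \<mu> {0<..} F" "set_integrable \<nu> {0<..} (\<lambda>y. F (- y))"
  shows "set_integrable \<phi> (- {0}) F"
    and "(LINT y:- {0}|\<phi>. F y) = d *\<^sub>R (LINT y:{0<..}|\<mu>. F y) + e *\<^sub>R (LINT y:{0<..}|\<nu>. F (- y))"
proof -
  note [measurable_cong] = s
  have Fm: "F \<in> borel_measurable \<phi>" by measurable
  \<comment> \<open>The negative jumps are reflected, which reduces them to the case of the positive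
    half-line.\<close>
  define \<phi>' where "\<phi>' = distr \<phi> borel uminus"
  have m: "uminus \<in> measurable \<phi> borel" by measurable
  have vim: "uminus -` {r<..} \<inter> space \<phi> = {..<- r}" for r :: real
    using sets_eq_imp_space_eq[OF s(1)] by auto
  have neg': "emeasure \<phi>' {r<..} = ennreal e * emeasure \<nu> {r<..}" if "r > 0" for r
    unfolding \<phi>'_def using neg[OF that] by (subst emeasure_distr[OF m]) (auto simp: vim)
  have s': "sets \<phi>' = sets borel" by (simp add: \<phi>'_def)
  note P = set_integral_of_tails[OF s(1,2) d(1) pos fin(1) F int(1)]
  have F': "(\<lambda>y. F (- y)) \<in> borel_measurable borel" by measurable
  note N = set_integral_of_tails[OF s' s(3) d(2) neg' fin(2) F' int(2)]
  have ind: "indicator {0<..} (- y) = (indicator {..<0} y :: real)" for y :: real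
    by (auto split: split_indicator)
  have F2: "(\<lambda>x. indicat_real {0<..} x *\<^sub>R F (- x)) \<in> borel_measurable borel" by measurable
  have N1: "set_integrable \<phi> {..<0} F"
    using N(1) unfolding \<phi>'_def set_integrable_def integrable_distr_eq[OF m F2] by (simp add: ind)
  have N2: "(LINT y:{0<..}|\<phi>'. F (- y)) = (LINT y:{..<0}|\<phi>. F y)"
    unfolding \<phi>'_def set_lebesgue_integral_def integral_distr[OF m F2] by (simp add: ind)
  have un: "- {0::real} = {0<..} \<union> {..<0}" by auto
  show "set_integrable \<phi> (- {0}) F"
    unfolding un by (rule set_integrable_Un[OF P(1) N1]) (auto simp: s)
  have "(LINT y:- {0}|\<phi>. F y) = (LINT y:{0<..}|\<phi>. F y) + (LINT y:{..<0}|\<phi>. F y)"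
    unfolding un by (rule set_integral_Un[OF _ P(1) N1]) auto
  then show "(LINT y:- {0}|\<phi>. F y) = d *\<^sub>R (LINT y:{0<..}|\<mu>. F y) + e *\<^sub>R (LINT y:{0<..}|\<nu>. F (- y))"
    using P(2) N(2) N2 by simp
qed

section \<open>Integrability of truncated powers from tail bounds\<close>

lemma emeasure_tail_le_powr:
  assumes c: "c > 1" and \<alpha>: "\<alpha> > 0" and ad: "admissable c \<alpha> \<theta>" and \<mu>: "is_phi_measure \<alpha> \<theta> \<mu>"
  obtains K where "K > 0" "\<And>r. r > 0 \<Longrightarrow> emeasure \<mu> {r<..} \<le> ennreal (K * r powr (- \<alpha>))"
proof -
  obtain m K where K: "m > 0" "\<And>y. m \<le> \<theta> y" "\<And>y. \<theta> y \<le> K" by (metis admissable_bounds[OF c \<alpha> ad])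
  have "K > 0" using K(1) K(2)[of 0] K(3)[of 0] by linarith
  then show thesis
    using is_phi_measureD(3)[OF \<mu>] K
    by (intro that[of K]) (auto intro!: ennreal_leI simp: mult.commute[of _ "_ powr _"])
qed

text \<open>Splitting the half-line at the powers of \<open>2\<close> bounds the integral by two geometric series.\<close>

lemma nn_integral_min_powr_less_top:
  fixes \<mu> :: "real measure"
  assumes s[measurable_cong]: "sets \<mu> = sets borel"
    and K: "\<And>r. r > 0 \<Longrightarrow> emeasure \<mu> {r<..} \<le> ennreal (K * r powr (- \<alpha>))" "K > 0"
    and ex: "0 \<le> \<gamma>" "\<gamma> < \<alpha>" "\<alpha> < \<beta>"
  shows "(\<integral>\<^sup>+y. ennreal (indicator {0<..} y * min (y powr \<beta>) (y powr \<gamma>)) \<partial>\<mu>) < \<infinity>"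
proof -
  \<comment> \<open>On the block from 2^(-n-1) to 2^(-n) the power with exponent \<beta> is at most
    \<open>?u n\<close>; on the block from 2^n to 2^(n+1) the power with exponent \<gamma> is at
    most \<open>?w n\<close>. Each block is enlarged to the whole tail beyond its lower end, because
    only tails can be measured.\<close>
  let ?a = "\<lambda>n::nat. (2::real) powr (- real n - 1)" and ?b = "\<lambda>n::nat. (2::real) powr real n"
  let ?u = "\<lambda>n::nat. (2::real) powr (- real n * \<beta>)" and ?w = "\<lambda>n::nat. (2::real) powr ((real n + 1) * \<gamma>)"
  let ?S = "\<lambda>y. (\<Sum>n. ennreal (?u n) * indicator {?a n<..} y) + (\<Sum>n. ennreal (?w n) * indicator {?b n<..} y)"
  have pt: "ennreal (indicator {0<..} y * min (y powr \<beta>) (y powr \<gamma>)) \<le> ?S y" for y :: real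
  proof (cases "y > 0")
    case False
    then show ?thesis by simp
  next
    case y: True
    define l where "l = log 2 y"
    have yl: "y = 2 powr l" using y by (simp add: l_def)
    have one: "f n \<le> (\<Sum>n. f n)" for f :: "nat \<Rightarrow> ennreal" and n
      using sum_le_suminf[of f "{n}"] by simp
    show ?thesis
    proof (cases "l \<le> 0")
      case True
      \<comment> \<open>Floor here and ceiling minus one below: both place y strictly above the
        lower end of its block, as the open tails require.\<close>
      define n where "n = nat \<lfloor>- l\<rfloor>"
      have n: "real n \<le> - l" "- l < real n + 1" using True unfolding n_def by linarith+
      have "l * \<beta> \<le> - real n * \<beta>" using n ex by (intro mult_right_mono) auto
      then have "y powr \<beta> \<le> ?u n" unfolding yl powr_powr by (intro powr_mono) auto
      then have "ennreal (indicator {0<..} y * min (y powr \<beta>) (y powr \<gamma>)) \<le> ennreal (?u n) * indicator {?a n<..} y"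
        using n y by (auto simp: yl intro!: ennreal_leI min.coboundedI1)
      also have "\<dots> \<le> (\<Sum>n. ennreal (?u n) * indicator {?a n<..} y)" by (rule one)
      also have "\<dots> \<le> ?S y" by simp
      finally show ?thesis .
    next
      case False
      define n where "n = nat (\<lceil>l\<rceil> - 1)"
      have n: "real n < l" "l \<le> real n + 1" using False unfolding n_def by linarith+
      have "l * \<gamma> \<le> (real n + 1) * \<gamma>" using n ex by (intro mult_right_mono) auto
      then have "y powr \<gamma> \<le> ?w n" unfolding yl powr_powr by (intro powr_mono) auto
      then have "ennreal (indicator {0<..} y * min (y powr \<beta>) (y powr \<gamma>)) \<le> ennreal (?w n) * indicator {?b n<..} y"
        using n y by (auto simp: yl intro!: ennreal_leI min.coboundedI2)
      also have "\<dots> \<le> (\<Sum>n. ennreal (?w n) * indicator {?b n<..} y)" by (rule one)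
      also have "\<dots> \<le> ?S y" by simp
      finally show ?thesis .
    qed
  qed
  have geo: "(\<Sum>n. ennreal (C * q ^ n)) < \<infinity>" if "C \<ge> 0" "0 \<le> q" "q < 1" for C q :: real
    unfolding infinity_ennreal_def less_top[symmetric]
    by (rule ennreal_suminf_neq_top) (use that in \<open>auto intro: summable_mult summable_geometric\<close>)
  have "(\<integral>\<^sup>+y. ennreal (indicator {0<..} y * min (y powr \<beta>) (y powr \<gamma>)) \<partial>\<mu>) \<le> (\<integral>\<^sup>+y. ?S y \<partial>\<mu>)"
    by (intro nn_integral_mono pt)
  also have "\<dots> = (\<Sum>n. ennreal (?u n) * emeasure \<mu> {?a n<..}) + (\<Sum>n. ennreal (?w n) * emeasure \<mu> {?b n<..})"
    by (subst nn_integral_add, measurable)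
       (simp add: nn_integral_suminf nn_integral_cmult_indicator s)
  \<comment> \<open>The tail bound turns the sums into geometric series with ratios
    2^(\<alpha>-\<beta>) and 2^(\<gamma>-\<alpha>), both below 1 exactly because \<gamma> < \<alpha>
    < \<beta>.\<close>
  also have "\<dots> \<le> (\<Sum>n. ennreal (K * 2 powr \<alpha> * (2 powr (\<alpha> - \<beta>)) ^ n)) + (\<Sum>n. ennreal (K * 2 powr \<gamma> * (2 powr (\<gamma> - \<alpha>)) ^ n))"
  proof (intro add_mono suminf_le)
    fix n
    have "ennreal (?u n) * emeasure \<mu> {?a n<..} \<le> ennreal (?u n) * ennreal (K * ?a n powr (- \<alpha>))"
      by (intro mult_left_mono K) auto
    also have "\<dots> = ennreal (K * (2 powr (- real n * \<beta>) * 2 powr ((- real n - 1) * - \<alpha>)))"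
      using K(2) by (simp add: ennreal_mult[symmetric] powr_powr ac_simps)
    also have "2 powr (- real n * \<beta>) * 2 powr ((- real n - 1) * - \<alpha>) = 2 powr \<alpha> * (2 powr (\<alpha> - \<beta>)) ^ n"
      by (simp add: powr_realpow[symmetric] powr_powr flip: powr_add) (simp add: algebra_simps)
    also have "K * (2 powr \<alpha> * (2 powr (\<alpha> - \<beta>)) ^ n) = K * 2 powr \<alpha> * (2 powr (\<alpha> - \<beta>)) ^ n" by simp
    finally show "ennreal (?u n) * emeasure \<mu> {?a n<..} \<le> ennreal (K * 2 powr \<alpha> * (2 powr (\<alpha> - \<beta>)) ^ n)" .
    have "ennreal (?w n) * emeasure \<mu> {?b n<..} \<le> ennreal (?w n) * ennreal (K * ?b n powr (- \<alpha>))"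
      by (intro mult_left_mono K) auto
    also have "\<dots> = ennreal (K * (2 powr ((real n + 1) * \<gamma>) * 2 powr (real n * - \<alpha>)))"
      using K(2) by (simp add: ennreal_mult[symmetric] powr_powr ac_simps)
    also have "2 powr ((real n + 1) * \<gamma>) * 2 powr (real n * - \<alpha>) = 2 powr \<gamma> * (2 powr (\<gamma> - \<alpha>)) ^ n"
      by (simp add: powr_realpow[symmetric] powr_powr flip: powr_add) (simp add: algebra_simps)
    also have "K * (2 powr \<gamma> * (2 powr (\<gamma> - \<alpha>)) ^ n) = K * 2 powr \<gamma> * (2 powr (\<gamma> - \<alpha>)) ^ n" by simp
    finally show "ennreal (?w n) * emeasure \<mu> {?b n<..} \<le> ennreal (K * 2 powr \<gamma> * (2 powr (\<gamma> - \<alpha>)) ^ n)" .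
  qed auto
  also have "\<dots> < \<infinity>"
  proof -
    have "2 powr (\<alpha> - \<beta>) < 2 powr (0::real)" "2 powr (\<gamma> - \<alpha>) < 2 powr (0::real)"
      using ex by (intro powr_less_mono; simp)+
    then show ?thesis using geo K(2) by (simp add: ennreal_add_less_top)
  qed
  finally show ?thesis .
qed

section \<open>The compensated kernel and its symbol\<close>

definition compensator :: "real \<Rightarrow> real \<Rightarrow> real" where
  "compensator \<alpha> y = (if \<alpha> < 1 then 0 else if \<alpha> = 1 then sin y else y)"

definition levy_kernel :: "real \<Rightarrow> real \<Rightarrow> real \<Rightarrow> complex" where
  "levy_kernel \<alpha> k y = iexp (k * y) - 1 - \<i> * complex_of_real (k * compensator \<alpha> y)"

text \<open>In each case the exponent at 0 exceeds \<alpha> and the exponent at infinity lies below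
  it: 1 and 0, 2 and 0, 2 and 1. That is what integrability against tails of order r^(-\<alpha>)
  demands at either end.\<close>

definition kernel_bound :: "real \<Rightarrow> real \<Rightarrow> real" where
  "kernel_bound \<alpha> y = (if \<alpha> < 1 then min \<bar>y\<bar> 1 else if \<alpha> = 1 then min (y\<^sup>2) 1 else min (y\<^sup>2) \<bar>y\<bar>)"

lemma measurable_compensator[measurable]: "compensator \<alpha> \<in> borel_measurable borel"
  unfolding compensator_def[abs_def] by measurable

lemma measurable_kernel_bound[measurable]: "kernel_bound \<alpha> \<in> borel_measurable borel"
  unfolding kernel_bound_def[abs_def] by measurable

lemma measurable_levy_kernel[measurable (raw)]:
  assumes [measurable]: "f \<in> borel_measurable M" "g \<in> borel_measurable M"
  shows "(\<lambda>x. levy_kernel \<alpha> (f x) (g x)) \<in> borel_measurable M"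
  unfolding levy_kernel_def by measurable

lemma kernel_bound_nonneg: "0 \<le> kernel_bound \<alpha> y"
  by (auto simp: kernel_bound_def)

lemma kernel_bound_minus [simp]: "kernel_bound \<alpha> (- y) = kernel_bound \<alpha> y"
  by (auto simp: kernel_bound_def)

lemma compensator_minus [simp]: "compensator \<alpha> (- y) = - compensator \<alpha> y"
  by (auto simp: compensator_def)

text \<open>All three compensators are odd, so reflecting the jump amounts to reflecting the
  frequency. Hence the negative jumps enter the exponent as a symbol at - k.\<close>

lemma levy_kernel_minus: "levy_kernel \<alpha> k (- y) = levy_kernel \<alpha> (- k) y"
  by (simp add: levy_kernel_def)

lemma levy_kernel_0 [simp]: "levy_kernel \<alpha> 0 y = 0"
  by (simp add: levy_kernel_def)

lemma Re_levy_kernel: "Re (levy_kernel \<alpha> k y) = cos (k * y) - 1"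
  by (simp add: levy_kernel_def Re_exp)

lemma cmod_iexp_minus_le:
  fixes u :: real
  shows "cmod (iexp u - 1) \<le> \<bar>u\<bar>" "cmod (iexp u - 1) \<le> 2"
    "cmod (iexp u - 1 - \<i> * u) \<le> u\<^sup>2 / 2" "cmod (iexp u - 1 - \<i> * u) \<le> 2 * \<bar>u\<bar>"
  using iexp_approx1[of u 0] iexp_approx2[of u 0] iexp_approx1[of u 1] iexp_approx2[of u 1]
  by (auto simp: power2_eq_square algebra_simps)

lemma abs_sin_minus_le: "\<bar>sin u - u\<bar> \<le> u\<^sup>2 / 2" for u :: real
  using order_trans[OF abs_Im_le_cmod cmod_iexp_minus_le(3)[of u]] by (simp add: Im_exp)

lemma abs_le_one_plus_square: "\<bar>k\<bar> \<le> 1 + k\<^sup>2" for k :: real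
proof -
  have "0 \<le> (\<bar>k\<bar> - 1)\<^sup>2" by simp
  then have "2 * \<bar>k\<bar> \<le> 1 + k\<^sup>2" by (simp add: power2_diff)
  then show ?thesis by linarith
qed

text \<open>Near 0 the bound comes from the Taylor remainder of the exponential, far away from
  boundedness or linear growth. Coarse powers of k are all replaced by 1 + k^2, so that one
  integrable function of y serves every frequency. The constant 3 arises for \<alpha> = 1 and large
  jumps, as 2 + 1.\<close>

lemma norm_levy_kernel_le: "norm (levy_kernel \<alpha> k y) \<le> 3 * (1 + k\<^sup>2) * kernel_bound \<alpha> y"
proof -
  have kb: "\<bar>k\<bar> \<le> 1 + k\<^sup>2" by (rule abs_le_one_plus_square)
  have ky: "cmod (iexp (k * y) - 1 - \<i> * complex_of_real (k * y)) \<le> (1 + k\<^sup>2) * y\<^sup>2 / 2"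
  proof -
    have "k\<^sup>2 * y\<^sup>2 \<le> (1 + k\<^sup>2) * y\<^sup>2" by (intro mult_right_mono) auto
    then show ?thesis using cmod_iexp_minus_le(3)[of "k * y"] by (simp add: power_mult_distrib)
  qed
  have ky1: "\<bar>k * y\<bar> \<le> (1 + k\<^sup>2) * \<bar>y\<bar>" using kb by (simp add: abs_mult mult_right_mono)
  have two: "2 \<le> 3 * (1 + k\<^sup>2)" by simp
  consider "\<alpha> < 1" | "\<alpha> = 1" "\<bar>y\<bar> \<le> 1" | "\<alpha> = 1" "\<bar>y\<bar> > 1" | "\<alpha> > 1" by linarith
  then show ?thesis
  proof cases
    case 1
    have "0 \<le> (1 + k\<^sup>2) * \<bar>y\<bar>" by simp
    then have "\<bar>k * y\<bar> \<le> 3 * (1 + k\<^sup>2) * \<bar>y\<bar>" using ky1 by linarith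
    then have "cmod (iexp (k * y) - 1) \<le> 3 * (1 + k\<^sup>2) * \<bar>y\<bar>" "cmod (iexp (k * y) - 1) \<le> 3 * (1 + k\<^sup>2)"
      using cmod_iexp_minus_le(1,2)[of "k * y"] two by linarith+
    then show ?thesis using 1
      by (auto simp: levy_kernel_def compensator_def kernel_bound_def min_def)
  next
    case 2
    \<comment> \<open>The sine is traded for y at the cost of an error that is quadratic in y as
      well.\<close>
    have "levy_kernel \<alpha> k y = (iexp (k * y) - 1 - \<i> * complex_of_real (k * y)) - \<i> * complex_of_real (k * (sin y - y))"
      using 2 by (simp add: levy_kernel_def compensator_def algebra_simps)
    also have "norm \<dots> \<le> cmod (iexp (k * y) - 1 - \<i> * complex_of_real (k * y)) + \<bar>k\<bar> * \<bar>sin y - y\<bar>"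
      by (rule order_trans[OF norm_triangle_ineq4]) (simp add: norm_mult abs_mult flip: of_real_mult of_real_diff)
    also have "\<bar>k\<bar> * \<bar>sin y - y\<bar> \<le> (1 + k\<^sup>2) * (y\<^sup>2 / 2)"
      by (intro mult_mono kb abs_sin_minus_le) auto
    finally have *: "norm (levy_kernel \<alpha> k y) \<le> (1 + k\<^sup>2) * y\<^sup>2" using ky by linarith
    have "y\<^sup>2 \<le> 1" using 2 by (simp add: abs_square_le_1)
    moreover have "0 \<le> (1 + k\<^sup>2) * y\<^sup>2" by simp
    ultimately have "norm (levy_kernel \<alpha> k y) \<le> 3 * (1 + k\<^sup>2) * y\<^sup>2" using * by linarith
    then show ?thesis using 2 \<open>y\<^sup>2 \<le> 1\<close> by (simp add: kernel_bound_def)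
  next
    case 3
    have "norm (levy_kernel \<alpha> k y) \<le> cmod (iexp (k * y) - 1) + \<bar>k\<bar> * \<bar>sin y\<bar>"
      using 3 unfolding levy_kernel_def compensator_def
      by (intro order_trans[OF norm_triangle_ineq4]) (simp add: norm_mult abs_mult)
    also have "\<dots> \<le> 2 + (1 + k\<^sup>2)"
      by (intro add_mono cmod_iexp_minus_le(2) order_trans[OF mult_left_le kb]) auto
    also have "\<dots> \<le> 3 * (1 + k\<^sup>2)" by simp
    finally have "norm (levy_kernel \<alpha> k y) \<le> 3 * (1 + k\<^sup>2)" .
    moreover have "\<not> y\<^sup>2 < 1" using 3 abs_square_less_1[of y] by simp
    ultimately show ?thesis using 3 by (simp add: kernel_bound_def)
  next
    case 4
    have "0 \<le> (1 + k\<^sup>2) * y\<^sup>2" "0 \<le> (1 + k\<^sup>2) * \<bar>y\<bar>" by simp_all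
    moreover have e: "levy_kernel \<alpha> k y = iexp (k * y) - 1 - \<i> * complex_of_real (k * y)"
      using 4 by (simp add: levy_kernel_def compensator_def)
    moreover have "norm (levy_kernel \<alpha> k y) \<le> 2 * ((1 + k\<^sup>2) * \<bar>y\<bar>)"
      unfolding e by (rule order_trans[OF cmod_iexp_minus_le(4) mult_left_mono[OF ky1]]) simp
    moreover have "norm (levy_kernel \<alpha> k y) \<le> (1 + k\<^sup>2) * y\<^sup>2 / 2" unfolding e by (rule ky)
    ultimately have "norm (levy_kernel \<alpha> k y) \<le> 3 * (1 + k\<^sup>2) * y\<^sup>2" "norm (levy_kernel \<alpha> k y) \<le> 3 * (1 + k\<^sup>2) * \<bar>y\<bar>"
      by linarith+
    then show ?thesis using 4 by (auto simp: kernel_bound_def min_def)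
  qed
qed

text \<open>The truncation y / (1 + y^2) and the compensator differ only by an integrable function;
  hence the integral in the drift converges and the kernel may be recompensated.\<close>

lemma abs_compensator_diff_le: "\<bar>y / (1 + y\<^sup>2) - compensator \<alpha> y\<bar> \<le> 2 * kernel_bound \<alpha> y"
proof -
  have pos: "0 < 1 + y\<^sup>2" by (simp add: add_pos_nonneg)
  have d1: "\<bar>y / (1 + y\<^sup>2)\<bar> \<le> \<bar>y\<bar>" using pos by (simp add: abs_mult field_simps)
  have d2: "\<bar>y / (1 + y\<^sup>2)\<bar> \<le> 1" using pos abs_le_one_plus_square[of y] by (simp add: field_simps)
  have "y / (1 + y\<^sup>2) - y = - (y * (y\<^sup>2 / (1 + y\<^sup>2)))" using pos by (simp add: field_simps)
  then have e: "\<bar>y / (1 + y\<^sup>2) - y\<bar> = \<bar>y\<bar> * (y\<^sup>2 / (1 + y\<^sup>2))" using pos by (simp add: abs_mult)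
  have q: "y\<^sup>2 / (1 + y\<^sup>2) \<le> 1" "y\<^sup>2 / (1 + y\<^sup>2) \<le> \<bar>y\<bar>"
  proof -
    show "y\<^sup>2 / (1 + y\<^sup>2) \<le> 1" using pos by (simp add: field_simps)
    have "y\<^sup>2 = \<bar>y\<bar> * \<bar>y\<bar>" by (simp add: power2_eq_square)
    also have "\<dots> \<le> \<bar>y\<bar> * (1 + y\<^sup>2)" by (intro mult_left_mono abs_le_one_plus_square) auto
    finally show "y\<^sup>2 / (1 + y\<^sup>2) \<le> \<bar>y\<bar>" using pos by (simp add: field_simps)
  qed
  have e1: "\<bar>y / (1 + y\<^sup>2) - y\<bar> \<le> \<bar>y\<bar>" using mult_left_le[OF q(1), of "\<bar>y\<bar>"] unfolding e by simp
  have e2: "\<bar>y / (1 + y\<^sup>2) - y\<bar> \<le> y\<^sup>2"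
    using mult_left_mono[OF q(2), of "\<bar>y\<bar>"] unfolding e by (simp add: power2_eq_square)
  consider "\<alpha> < 1" | "\<alpha> = 1" "\<bar>y\<bar> \<le> 1" | "\<alpha> = 1" "\<bar>y\<bar> > 1" | "\<alpha> > 1" by linarith
  then show ?thesis
  proof cases
    case 1
    then show ?thesis using d1 d2 by (auto simp: compensator_def kernel_bound_def min_def)
  next
    case 2
    have "\<bar>y / (1 + y\<^sup>2) - sin y\<bar> \<le> 2 * y\<^sup>2"
      using e2 abs_sin_minus_le[of y] zero_le_power2[of y] by linarith
    moreover have "y\<^sup>2 \<le> 1" using 2 by (simp add: abs_square_le_1)
    ultimately show ?thesis using 2 by (simp add: compensator_def kernel_bound_def)
  next
    case 3
    have "\<bar>y / (1 + y\<^sup>2) - sin y\<bar> \<le> 2" using d2 abs_sin_le_one[of y] by linarith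
    moreover have "\<not> y\<^sup>2 < 1" using 3 abs_square_less_1[of y] by simp
    ultimately show ?thesis using 3 by (simp add: compensator_def kernel_bound_def)
  next
    case 4
    then show ?thesis using e1 e2 by (auto simp: compensator_def kernel_bound_def min_def)
  qed
qed

lemma set_integrable_kernel_bound:
  assumes c: "c > 1" and \<alpha>: "0 < \<alpha>" "\<alpha> < 2" and ad: "admissable c \<alpha> \<theta>" and \<mu>: "is_phi_measure \<alpha> \<theta> \<mu>"
  shows "set_integrable \<mu> {0<..} (kernel_bound \<alpha>)"
proof -
  note s[measurable_cong] = is_phi_measureD(1)[OF \<mu>]
  obtain K where K: "K > 0" "\<And>r. r > 0 \<Longrightarrow> emeasure \<mu> {r<..} \<le> ennreal (K * r powr (- \<alpha>))"
    by (metis emeasure_tail_le_powr[OF c \<alpha>(1) ad \<mu>])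
  obtain \<beta> \<gamma> where ex: "0 \<le> \<gamma>" "\<gamma> < \<alpha>" "\<alpha> < \<beta>"
    and eq: "\<And>y. y > 0 \<Longrightarrow> kernel_bound \<alpha> y = min (y powr \<beta>) (y powr \<gamma>)"
  proof (cases "\<alpha> < 1")
    case True
    then show thesis using \<alpha> by (intro that[of 0 1]) (auto simp: kernel_bound_def)
  next
    case False
    show thesis
    proof (cases "\<alpha> = 1")
      case True
      then show thesis by (intro that[of 0 2]) (auto simp: kernel_bound_def)
    next
      case f: False
      then show thesis using False \<alpha> by (intro that[of 1 2]) (auto simp: kernel_bound_def)
    qed
  qed
  have "(\<lambda>y. ennreal (norm (indicat_real {0<..} y *\<^sub>R kernel_bound \<alpha> y)))
      = (\<lambda>y. ennreal (indicator {0<..} y * min (y powr \<beta>) (y powr \<gamma>)))"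
    by (rule ext) (auto simp: eq kernel_bound_nonneg split: split_indicator)
  moreover have "(\<lambda>y. indicat_real {0<..} y *\<^sub>R kernel_bound \<alpha> y) \<in> borel_measurable \<mu>"
    by measurable
  ultimately show ?thesis
    using nn_integral_min_powr_less_top[OF s K(2,1) ex]
    by (auto simp: set_integrable_def integrable_iff_bounded)
qed

section \<open>The one-sided characteristic exponent, compensated as in the operators\<close>

definition symbol :: "real \<Rightarrow> real measure \<Rightarrow> real \<Rightarrow> complex" where
  "symbol \<alpha> \<mu> k = (LINT y:{0<..}|\<mu>. levy_kernel \<alpha> k y)"

context
  fixes \<alpha> :: real and \<mu> :: "real measure"
  assumes s[measurable_cong]: "sets \<mu> = sets borel"
    and G: "set_integrable \<mu> {0<..} (kernel_bound \<alpha>)"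
begin

lemma set_integrable_levy_kernel: "set_integrable \<mu> {0<..} (levy_kernel \<alpha> k)"
  unfolding set_integrable_def
proof (rule Bochner_Integration.integrable_bound)
  show "integrable \<mu> (\<lambda>y. 3 * (1 + k\<^sup>2) * (indicator {0<..} y *\<^sub>R kernel_bound \<alpha> y))"
    using G unfolding set_integrable_def by (rule integrable_mult_right)
  show "AE y in \<mu>. norm (indicat_real {0<..} y *\<^sub>R levy_kernel \<alpha> k y)
      \<le> norm (3 * (1 + k\<^sup>2) * (indicator {0<..} y *\<^sub>R kernel_bound \<alpha> y))"
    using norm_levy_kernel_le[of \<alpha> k] kernel_bound_nonneg[of \<alpha>]
    by (intro AE_I2) (auto simp: abs_mult split: split_indicator)
qed measurable

lemma norm_symbol_le: "norm (symbol \<alpha> \<mu> k) \<le> 3 * (LINT y:{0<..}|\<mu>. kernel_bound \<alpha> y) * (1 + k\<^sup>2)"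
proof -
  have "norm (symbol \<alpha> \<mu> k) \<le> (LINT y|\<mu>. 3 * (1 + k\<^sup>2) * (indicator {0<..} y *\<^sub>R kernel_bound \<alpha> y))"
    unfolding symbol_def set_lebesgue_integral_def
    by (rule Bochner_Integration.integral_norm_bound_integral)
       (use set_integrable_levy_kernel[of k] G norm_levy_kernel_le[of \<alpha> k] in
         \<open>auto simp: set_integrable_def simp del: real_scaleR_def mult_scaleR_right split: split_indicator\<close>)
  also have "\<dots> = 3 * (1 + k\<^sup>2) * (LINT y:{0<..}|\<mu>. kernel_bound \<alpha> y)"
    unfolding set_lebesgue_integral_def by (rule integral_mult_right_zero)
  finally show ?thesis by (simp add: algebra_simps)
qed

text \<open>Continuity is what later singles out the right logarithm of the characteristic function.
  Frequencies along a convergent sequence are bounded, so the separated bound on the kernel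
  dominates all of them at once.\<close>

lemma isCont_symbol: "isCont (symbol \<alpha> \<mu>) k"
  unfolding continuous_at_sequentially
proof safe
  fix u assume u: "u \<longlonglongrightarrow> k"
  then obtain B where B: "\<And>n. norm (u n) \<le> B" "B > 0"
    by (metis convergentI convergent_imp_Bseq BseqE)
  have B2: "(u n)\<^sup>2 \<le> B\<^sup>2" for n using B(1)[of n] B(2) by (simp add: abs_le_square_iff[symmetric])
  show "(symbol \<alpha> \<mu> \<circ> u) \<longlonglongrightarrow> symbol \<alpha> \<mu> k"
    unfolding comp_def symbol_def set_lebesgue_integral_def
  proof (rule integral_dominated_convergence)
    show "integrable \<mu> (\<lambda>y. 3 * (1 + B\<^sup>2) * (indicator {0<..} y *\<^sub>R kernel_bound \<alpha> y))"
      using G unfolding set_integrable_def by (rule integrable_mult_right)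
    have "norm (levy_kernel \<alpha> (u n) y) \<le> 3 * (1 + B\<^sup>2) * kernel_bound \<alpha> y" for n y
      by (rule order_trans[OF norm_levy_kernel_le]) (use B2[of n] in \<open>auto intro!: mult_right_mono simp: kernel_bound_nonneg\<close>)
    then show "AE y in \<mu>. norm (indicat_real {0<..} y *\<^sub>R levy_kernel \<alpha> (u n) y)
        \<le> 3 * (1 + B\<^sup>2) * (indicator {0<..} y *\<^sub>R kernel_bound \<alpha> y)" for n
      by (auto split: split_indicator)
    show "AE y in \<mu>. (\<lambda>n. indicat_real {0<..} y *\<^sub>R levy_kernel \<alpha> (u n) y) \<longlonglongrightarrow> indicat_real {0<..} y *\<^sub>R levy_kernel \<alpha> k y"
      unfolding levy_kernel_def by (intro AE_I2 tendsto_intros u)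
  qed measurable
qed

end

lemma symbol_0 [simp]: "symbol \<alpha> \<mu> 0 = 0"
  by (simp add: symbol_def)

text \<open>Only the jumps of size comparable to \<open>1 / \<bar>k\<bar>\<close> are used: their mass is at least a constant
  times \<open>\<bar>k\<bar> powr \<alpha>\<close>, since \<open>\<theta>\<close> takes the same value at both ends of the period.\<close>

lemma Re_symbol_le:
  assumes c: "c > 1" and \<alpha>: "0 < \<alpha>" "\<alpha> < 2" and ad: "admissable c \<alpha> \<theta>" and \<mu>: "is_phi_measure \<alpha> \<theta> \<mu>"
  obtains C where "C > 0" "\<And>k. Re (symbol \<alpha> \<mu> k) \<le> - C * \<bar>k\<bar> powr \<alpha>"
proof -
  note s[measurable_cong] = is_phi_measureD(1)[OF \<mu>]
  note G = set_integrable_kernel_bound[OF c \<alpha> ad \<mu>]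
  obtain m where m: "m > 0" "\<And>y. m \<le> \<theta> y" by (metis admissable_bounds[OF c \<alpha>(1) ad])
  define L where "L = c powr (1 / \<alpha>)"
  have L: "L > 1" unfolding L_def using c \<alpha> by (simp add: gr_one_powr)
  have La: "L powr (- \<alpha>) = 1 / c" unfolding L_def using c \<alpha> by (simp add: powr_powr powr_minus divide_inverse)
  have per: "\<theta> (y + ln L) = \<theta> y" for y using ad by (simp add: admissable_def L_def)
  \<comment> \<open>The least value of 1 - cos on the interval from 1 / L to 1, where the products
    of frequency and jump size will lie.\<close>
  define q where "q = 1 - cos (1 / L)"
  have q: "q > 0"
  proof -
    have "0 < 1 / L" "1 / L < 1" using L by auto
    then have "cos (1 / L) < cos 0" by (intro cos_monotone_0_pi) (use pi_gt3 in linarith)+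
    then show ?thesis by (simp add: q_def)
  qed
  define C where "C = q * (1 - 1 / c) * m * L powr \<alpha>"
  have "C > 0" using q c m L by (simp add: C_def)
  moreover have "Re (symbol \<alpha> \<mu> k) \<le> - C * \<bar>k\<bar> powr \<alpha>" for k
  proof (cases "k = 0")
    case True then show ?thesis by simp
  next
    case False
    \<comment> \<open>With this r the jumps in \<open>{r<..L * r}\<close> satisfy 1 / L <
      \<bar>k\<bar> y \<le> 1, and in logarithmic scale they fill exactly one period.\<close>
    define r where "r = 1 / (L * \<bar>k\<bar>)"
    have r: "r > 0" using L False by (simp add: r_def)
    then have r: "r > 0" "L * r > r" "r powr (- \<alpha>) = L powr \<alpha> * \<bar>k\<bar> powr \<alpha>"
      using L mult_strict_right_mono[of 1 L r] by (simp_all add: r_def powr_divide powr_mult powr_minus)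
    have fin: "emeasure \<mu> {x<..} \<noteq> \<infinity>" if "x > 0" for x using is_phi_measureD(3)[OF \<mu> that] by simp
    have meas: "measure \<mu> {x<..} = x powr (- \<alpha>) * \<theta> (ln x)" if "x > 0" for x
      using is_phi_measureD(3)[OF \<mu> that] m(1) m(2)[of "ln x"] by (simp add: measure_def)
    have ln: "ln (L * r) = ln r + ln L" using L r by (simp add: ln_mult)
    have "{r<..L * r} = {r<..} - {L * r<..}" by auto
    then have "measure \<mu> {r<..L * r} = measure \<mu> {r<..} - measure \<mu> {L * r<..}"
      using r fin[of r] L by (simp only:) (rule measure_Diff, auto simp: s)
    \<comment> \<open>Over one period \<theta> returns to its value while the power shrinks by
      L^(-\<alpha>) = 1 / c, so a fixed fraction of the tail mass lies in the block.\<close>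
    also have "\<dots> = r powr (- \<alpha>) * \<theta> (ln r) * (1 - 1 / c)"
      using r L by (simp add: meas ln per powr_mult La right_diff_distrib)
    finally have mass: "measure \<mu> {r<..L * r} = r powr (- \<alpha>) * \<theta> (ln r) * (1 - 1 / c)" .
    have finI: "emeasure \<mu> {r<..L * r} < \<infinity>"
    proof -
      have "emeasure \<mu> {r<..L * r} \<le> emeasure \<mu> {r<..}" by (rule emeasure_mono) (auto simp: s)
      also have "\<dots> < \<infinity>" using fin[OF r(1)] by (simp add: less_top[symmetric])
      finally show ?thesis .
    qed
    have "C * \<bar>k\<bar> powr \<alpha> = q * (r powr (- \<alpha>) * m * (1 - 1 / c))" by (simp add: C_def r(3))
    also have "\<dots> \<le> q * measure \<mu> {r<..L * r}"
      unfolding mass using q c m by (intro mult_left_mono mult_right_mono) auto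
    also have "\<dots> = (LINT y|\<mu>. q * indicator {r<..L * r} y)"
      using finI sets_eq_imp_space_eq[OF s] by simp
    also have "\<dots> \<le> (LINT y|\<mu>. - Re (indicator {0<..} y *\<^sub>R levy_kernel \<alpha> k y))"
    proof (rule integral_mono)
      show "integrable \<mu> (\<lambda>y. q * indicator {r<..L * r} y)" using finI s by (auto simp: integrable_real_indicator)
      show "integrable \<mu> (\<lambda>y. - Re (indicator {0<..} y *\<^sub>R levy_kernel \<alpha> k y))"
        using set_integrable_levy_kernel[OF s G, of k] unfolding set_integrable_def by (intro integrable_minus integrable_Re)
      fix y
      have "cos (k * y) \<le> cos (1 / L)" if "r < y" "y \<le> L * r"
      proof -
        have "1 / L \<le> \<bar>k\<bar> * y" "\<bar>k\<bar> * y \<le> 1" using that False L by (auto simp: r_def field_simps)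
        then have "cos (\<bar>k\<bar> * y) \<le> cos (1 / L)" using L pi_gt3 by (intro cos_monotone_0_pi_le) (auto intro: order_trans)
        moreover have "cos (\<bar>k\<bar> * y) = cos (k * y)" by (simp add: abs_if)
        ultimately show ?thesis by simp
      qed
      then show "q * indicator {r<..L * r} y \<le> - Re (indicator {0<..} y *\<^sub>R levy_kernel \<alpha> k y)"
        using r(1) by (auto simp: Re_levy_kernel q_def split: split_indicator)
    qed
    also have "\<dots> = - Re (symbol \<alpha> \<mu> k)"
      using set_integrable_levy_kernel[OF s G, of k]
      unfolding symbol_def set_lebesgue_integral_def set_integrable_def
      by (subst integral_Re[symmetric]) (simp_all only: integral_minus)
    finally show ?thesis by simp
  qed
  ultimately show thesis by (rule that)
qed

text \<open>Changing the compensator costs \<i> k times the integral of y / (1 + y^2) minus the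
  compensator, and this integral is a - v. So the drift a becomes the plain velocity v, and what
  remains are the two one-sided symbols.\<close>

lemma log_char_eq_symbol:
  assumes s: "sets \<phi> = sets borel" "sets \<mu> = sets borel" "sets \<nu> = sets borel"
    and d: "d \<ge> 0" "e \<ge> 0"
    and tails: "\<And>r. r > 0 \<Longrightarrow> emeasure \<phi> {r<..} = ennreal d * emeasure \<mu> {r<..}"
      "\<And>r. r > 0 \<Longrightarrow> emeasure \<phi> {..<- r} = ennreal e * emeasure \<nu> {r<..}"
    and fin: "\<And>r. r > 0 \<Longrightarrow> emeasure \<mu> {r<..} < \<infinity>" "\<And>r. r > 0 \<Longrightarrow> emeasure \<nu> {r<..} < \<infinity>"
    and G: "set_integrable \<mu> {0<..} (kernel_bound \<alpha>)" "set_integrable \<nu> {0<..} (kernel_bound \<alpha>)"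
    and a: "a = v + (LINT y:- {0}|\<phi>. y / (1 + y\<^sup>2) - compensator \<alpha> y)"
  shows "log_char a \<phi> k = \<i> * complex_of_real (v * k) + d *\<^sub>R symbol \<alpha> \<mu> k + e *\<^sub>R symbol \<alpha> \<nu> (- k)"
proof -
  have split: "set_integrable \<phi> (- {0}) F"
      "(LINT y:- {0}|\<phi>. F y) = d *\<^sub>R (LINT y:{0<..}|\<mu>. F y) + e *\<^sub>R (LINT y:{0<..}|\<nu>. F (- y))"
    if "F \<in> borel_measurable borel" "set_integrable \<mu> {0<..} F" "set_integrable \<nu> {0<..} (\<lambda>y. F (- y))"
    for F :: "real \<Rightarrow> complex"
    using tails fin that by (auto intro!: set_integral_minus_zero_split[OF s d])
  have "set_integrable M {0<..} F"
    if "sets M = sets borel" "set_integrable M {0<..} (kernel_bound \<alpha>)" and F: "F \<in> borel_measurable borel"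
      "\<And>y. norm (F y) \<le> K * kernel_bound \<alpha> y" for F :: "real \<Rightarrow> complex" and M K
    unfolding set_integrable_def
  proof (rule Bochner_Integration.integrable_bound)
    note [measurable] = F(1) and [measurable_cong] = that(1)
    show "integrable M (\<lambda>y. K * (indicator {0<..} y *\<^sub>R kernel_bound \<alpha> y))"
      using that(2) unfolding set_integrable_def by (rule integrable_mult_right)
    show "(\<lambda>x. indicat_real {0<..} x *\<^sub>R F x) \<in> borel_measurable M" by measurable
    show "AE y in M. norm (indicat_real {0<..} y *\<^sub>R F y) \<le> norm (K * (indicator {0<..} y *\<^sub>R kernel_bound \<alpha> y))"
      using F(2) by (intro AE_I2) (auto split: split_indicator intro: order_trans[OF _ abs_ge_self])
  qed
  note bnd = this
  have intF: "set_integrable \<phi> (- {0}) F"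
    if F[measurable]: "F \<in> borel_measurable borel" "\<And>y. norm (F y) \<le> K * kernel_bound \<alpha> y"
    for F :: "real \<Rightarrow> complex" and K
  proof (rule split(1))
    show "set_integrable \<mu> {0<..} F" by (rule bnd[OF s(2) G(1) F])
    show "set_integrable \<nu> {0<..} (\<lambda>y. F (- y))"
      by (rule bnd[OF s(3) G(2), where K = K]) (use F(2)[of "- _"] in auto)
  qed (rule F(1))
  let ?d = "\<lambda>y. y / (1 + y\<^sup>2) - compensator \<alpha> y"
  have intd: "set_integrable \<phi> (- {0}) (\<lambda>y. complex_of_real (?d y))"
    by (rule intF[where K = 2]) (use abs_compensator_diff_le[of _ \<alpha>] in \<open>auto simp flip: of_real_diff of_real_divide\<close>)
  have intk: "set_integrable \<phi> (- {0}) (levy_kernel \<alpha> k)"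
    by (rule intF[where K = "3 * (1 + k\<^sup>2)"]) (rule measurable_levy_kernel, simp, simp, rule norm_levy_kernel_le)
  have "(LINT y:- {0}|\<phi>. iexp (k * y) - 1 - \<i> * complex_of_real (k * y / (1 + y\<^sup>2)))
      = (LINT y:- {0}|\<phi>. levy_kernel \<alpha> k y - \<i> * complex_of_real k * complex_of_real (?d y))"
    by (intro arg_cong[where f = "set_lebesgue_integral \<phi> (- {0})"]) (auto simp: levy_kernel_def algebra_simps)
  also have "\<dots> = (LINT y:- {0}|\<phi>. levy_kernel \<alpha> k y) - (LINT y:- {0}|\<phi>. \<i> * complex_of_real k * complex_of_real (?d y))"
    by (rule set_integral_diff(2)[OF intk]) (rule set_integrable_mult_right, rule intd)
  also have "(LINT y:- {0}|\<phi>. \<i> * complex_of_real k * complex_of_real (?d y)) = \<i> * complex_of_real k * complex_of_real (a - v)"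
    unfolding a set_integral_mult_right set_integral_complex_of_real by simp
  also have "(LINT y:- {0}|\<phi>. levy_kernel \<alpha> k y) = d *\<^sub>R symbol \<alpha> \<mu> k + e *\<^sub>R symbol \<alpha> \<nu> (- k)"
  proof -
    have k: "set_integrable \<nu> {0<..} (\<lambda>y. levy_kernel \<alpha> k (- y))"
      unfolding levy_kernel_minus by (rule set_integrable_levy_kernel[OF s(3) G(2)])
    show ?thesis
      using split(2)[OF _ set_integrable_levy_kernel[OF s(2) G(1)] k] by (simp add: symbol_def levy_kernel_minus)
  qed
  finally show ?thesis by (simp add: log_char_def algebra_simps)
qed

section \<open>Fourier inversion\<close>

text \<open>The mean value inequality on the ball bounds the normalized Taylor remainder by 2 w, so
  dominated convergence along arbitrary sequences sends its integral to 0.\<close>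

lemma has_vector_derivative_lebesgue_integral:
  fixes f :: "real \<Rightarrow> 'a \<Rightarrow> 'b::{banach, second_countable_topology}"
  assumes e: "e > 0"
    and f: "\<And>t. t \<in> ball t0 e \<Longrightarrow> integrable M (f t)"
    and f': "\<And>t x. t \<in> ball t0 e \<Longrightarrow> x \<in> space M \<Longrightarrow> ((\<lambda>t. f t x) has_vector_derivative f' t x) (at t)"
    and meas: "f' t0 \<in> borel_measurable M"
    and bound: "\<And>t x. t \<in> ball t0 e \<Longrightarrow> x \<in> space M \<Longrightarrow> norm (f' t x) \<le> w x"
    and w: "integrable M w"
  shows "integrable M (f' t0)"
    and "((\<lambda>t. \<integral>x. f t x \<partial>M) has_vector_derivative (\<integral>x. f' t0 x \<partial>M)) (at t0)"
proof -
  have t0: "t0 \<in> ball t0 e" using e by simp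
  show int': "integrable M (f' t0)"
    by (rule Bochner_Integration.integrable_bound[OF w meas]) (use bound[OF t0] in \<open>auto intro!: AE_I2 intro: order_trans[OF _ abs_ge_self]\<close>)
  let ?R = "\<lambda>t x. (1 / norm (t - t0)) *\<^sub>R (f t x - (f t0 x + (t - t0) *\<^sub>R f' t0 x))"
  have Rint: "integrable M (?R t)" if "t \<in> ball t0 e" for t
    using f[OF that] f[OF t0] int' by auto
  have Rbound: "norm (?R t x) \<le> 2 * w x" if t: "t \<in> ball t0 e" and x: "x \<in> space M" for t x
  proof -
    have "norm (f t x - f t0 x - (t - t0) *\<^sub>R f' t0 x) \<le> norm (t - t0) * (2 * w x)"
    proof (rule vector_differentiable_bound_linearization[where S = "ball t0 e" and f' = "\<lambda>t. f' t x"])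
      show "closed_segment t0 t \<subseteq> ball t0 e" using t t0 by (intro closed_segment_subset) auto
      show "norm (f' s x - f' t0 x) \<le> 2 * w x" if "s \<in> ball t0 e" for s
        using norm_triangle_ineq4[of "f' s x" "f' t0 x"] bound[OF that x] bound[OF t0 x] by linarith
    qed (use f' x t0 in \<open>auto intro: has_vector_derivative_at_within\<close>)
    then have "norm (f t x - (f t0 x + (t - t0) *\<^sub>R f' t0 x)) \<le> 2 * w x * \<bar>t - t0\<bar>"
      by (simp add: diff_diff_eq ac_simps)
    \<comment> \<open>At t = t0 the quotient 1 / 0 is 0, so the remainder vanishes and the bound
      only needs w to be nonnegative.\<close>
    then show ?thesis using order_trans[OF norm_ge_zero bound[OF t0 x]]
      by (cases "t = t0") (auto simp: divide_le_eq)
  qed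
  have Reval: "(\<integral>x. ?R t x \<partial>M) = (1 / norm (t - t0)) *\<^sub>R ((\<integral>x. f t x \<partial>M) - ((\<integral>x. f t0 x \<partial>M) + (t - t0) *\<^sub>R (\<integral>x. f' t0 x \<partial>M)))"
    if "t \<in> ball t0 e" for t
    using f[OF that] f[OF t0] int' by simp
  have lim0: "((\<lambda>t. \<integral>x. ?R t x \<partial>M) \<longlongrightarrow> 0) (at t0)"
    unfolding tendsto_at_iff_sequentially comp_def
  proof (intro allI impI)
    fix u assume u: "\<forall>i. u i \<in> UNIV - {t0}" "u \<longlonglongrightarrow> t0"
    then have "\<forall>\<^sub>F i in sequentially. u i \<in> ball t0 e"
      using e by (intro topological_tendstoD) auto
    \<comment> \<open>The domination holds only inside the ball, so the sequence is shifted past its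
      first N terms.\<close>
    then obtain N where N: "\<And>i. i \<ge> N \<Longrightarrow> u i \<in> ball t0 e" by (auto simp: eventually_sequentially)
    have "(\<lambda>i. \<integral>x. ?R (u (i + N)) x \<partial>M) \<longlonglongrightarrow> (\<integral>x. 0 \<partial>M)"
    proof (rule integral_dominated_convergence)
      show "integrable M (\<lambda>x. 2 * w x)" using w by simp
      show "?R (u (i + N)) \<in> borel_measurable M" for i using Rint[OF N] by auto
      show "AE x in M. norm (?R (u (i + N)) x) \<le> 2 * w x" for i
        using Rbound[OF N] by (intro AE_I2) auto
      show "AE x in M. (\<lambda>i. ?R (u (i + N)) x) \<longlonglongrightarrow> 0"
      proof (rule AE_I2)
        fix x assume "x \<in> space M"
        then have "((\<lambda>t. ?R t x) \<longlongrightarrow> 0) (at t0)"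
          using f'[OF t0] by (simp add: has_vector_derivative_def has_derivative_within)
        then have "(\<lambda>i. ?R (u i) x) \<longlonglongrightarrow> 0"
          using u by (auto simp: tendsto_at_iff_sequentially comp_def)
        then show "(\<lambda>i. ?R (u (i + N)) x) \<longlonglongrightarrow> 0" by (rule LIMSEQ_ignore_initial_segment)
      qed
    qed auto
    then show "(\<lambda>i. \<integral>x. ?R (u i) x \<partial>M) \<longlonglongrightarrow> 0"
      by (simp add: LIMSEQ_offset[where k = N])
  qed
  show "((\<lambda>t. \<integral>x. f t x \<partial>M) has_vector_derivative (\<integral>x. f' t0 x \<partial>M)) (at t0)"
    unfolding has_vector_derivative_def has_derivative_within
  proof
    show "((\<lambda>t. (1 / norm (t - t0)) *\<^sub>R ((\<integral>x. f t x \<partial>M) - ((\<integral>x. f t0 x \<partial>M) + (t - t0) *\<^sub>R (\<integral>x. f' t0 x \<partial>M)))) \<longlongrightarrow> 0) (at t0)"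
      using e Reval by (intro Lim_transform_within_open[OF lim0, of "ball t0 e"]) auto
  qed (rule bounded_linear_scaleR_left)
qed

section \<open>The inverse transform, with the sign and factor that undo \<open>char\<close>\<close>

definition inv_fourier :: "(real \<Rightarrow> complex) \<Rightarrow> real \<Rightarrow> complex" where
  "inv_fourier g x = complex_of_real (1 / (2 * pi)) * (CLINT k|lborel. iexp (- (k * x)) * g k)"

lemma inv_fourier_integrable:
  assumes "integrable lborel g"
  shows "integrable lborel (\<lambda>k. iexp (- (k * x)) * g k)"
  by (rule Bochner_Integration.integrable_bound[OF assms]) (use assms in \<open>auto simp: norm_mult\<close>)

lemma inv_fourier_add:
  assumes "integrable lborel g" "integrable lborel h"
  shows "inv_fourier (\<lambda>k. g k + h k) x = inv_fourier g x + inv_fourier h x"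
  using inv_fourier_integrable[OF assms(1), of x] inv_fourier_integrable[OF assms(2), of x]
  by (simp add: inv_fourier_def distrib_left)

lemma inv_fourier_mult: "inv_fourier (\<lambda>k. c * g k) x = c * inv_fourier g x"
  by (simp add: inv_fourier_def mult.left_commute[of _ c])

lemma has_vector_derivative_inv_fourier:
  assumes g: "integrable lborel g" and g': "integrable lborel (\<lambda>k. k * norm (g k))"
  shows "(inv_fourier g has_vector_derivative inv_fourier (\<lambda>k. - \<i> * k * g k) x) (at x)"
proof -
  have [measurable]: "g \<in> borel_measurable borel" using g by auto
  have "((\<lambda>x. CLINT k|lborel. iexp (- (k * x)) * g k) has_vector_derivative
      (CLINT k|lborel. iexp (- (k * x)) * (- \<i> * k * g k))) (at x)"
  proof (rule has_vector_derivative_lebesgue_integral(2)[where e = 1 and w = "\<lambda>k. \<bar>k * norm (g k)\<bar>"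
        and f' = "\<lambda>x k. iexp (- (k * x)) * (- \<i> * k * g k)"])
    show "integrable lborel (\<lambda>k. iexp (- (k * t)) * g k)" for t by (rule inv_fourier_integrable[OF g])
    show "((\<lambda>x. iexp (- (k * x)) * g k) has_vector_derivative iexp (- (k * t)) * (- \<i> * k * g k)) (at t)" for t k
      by (auto intro!: derivative_eq_intros has_vector_derivative_real_field simp: algebra_simps)
    show "integrable lborel (\<lambda>k. \<bar>k * norm (g k)\<bar>)" using g' by simp
  qed (auto simp: norm_mult abs_mult)
  then show ?thesis
    unfolding inv_fourier_def[abs_def] by (rule has_vector_derivative_mult_right)
qed

lemma isCont_inv_fourier:
  assumes g: "integrable lborel g"
  shows "isCont (inv_fourier g) x"
  unfolding continuous_at_sequentially
proof safe
  fix u assume u: "u \<longlonglongrightarrow> x"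
  have [measurable]: "g \<in> borel_measurable borel" using g by auto
  show "(inv_fourier g \<circ> u) \<longlonglongrightarrow> inv_fourier g x"
    unfolding inv_fourier_def comp_def
    by (intro tendsto_mult tendsto_const integral_dominated_convergence[where w = "\<lambda>k. norm (g k)"])
       (use g in \<open>auto simp: norm_mult intro!: tendsto_intros u\<close>)
qed

text \<open>The inversion formula shows that the distribution function and an explicit
  antiderivative \<open>Q\<close> have equal increments between points without mass. Such points are
  dense, and right-continuity carries the equality to all points; differentiability then excludes
  atoms after the fact.\<close>

lemma (in real_distribution) has_real_derivative_cdf:
  assumes int: "integrable lborel (char M)"
  shows "(cdf M has_real_derivative Re (inv_fourier (char M) x)) (at x)"
proof -
  \<comment> \<open>The kernel of the inversion formula, anchored at 0 to cancel the singularity at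
    t = 0. Its differences \<open>?K b - ?K a\<close> are the integrands of that formula for a and
    b.\<close>
  let ?K = "\<lambda>x t. (1 - iexp (- (t * x))) / (\<i> * complex_of_real t) * char M t"
  define Q where "Q x = complex_of_real (1 / (2 * pi)) * (CLINT t|lborel. ?K x t)" for x
  have normK: "norm ((iexp (- (t * a)) - iexp (- (t * b))) / (\<i> * complex_of_real t)) \<le> \<bar>b - a\<bar>" for t a b
  proof (cases "t = 0")
    case False
    show ?thesis
    proof (cases "a \<le> b")
      case True
      then show ?thesis using Levy_Inversion_aux2[of "- b" "- a" t] False
        by (simp add: norm_divide norm_mult)
    next
      case F: False
      then show ?thesis using Levy_Inversion_aux2[of "- a" "- b" t] False
        by (simp add: norm_divide norm_mult norm_minus_commute)
    qed
  qed simp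
  have Kint2: "integrable lborel (\<lambda>t. (iexp (- (t * a)) - iexp (- (t * b))) / (\<i> * complex_of_real t) * char M t)" for a b
    by (rule Bochner_Integration.integrable_bound[where f = "\<lambda>t. \<bar>b - a\<bar> * norm (char M t)"])
       (use int normK in \<open>auto simp: norm_mult simp del: times_divide_eq_left intro!: AE_I2 mult_right_mono\<close>)
  have Kint: "integrable lborel (?K x)" for x using Kint2[of 0 x] by simp
  have deriv: "(Q has_vector_derivative inv_fourier (char M) x) (at x)" for x
  proof -
    \<comment> \<open>Division by zero makes \<open>?K x 0\<close> equal to 0 for every x, so the
      derivative at t = 0 is 0 instead of the expected value; a single frequency does not affect the
      integral.\<close>
    let ?K' = "\<lambda>x t. if t = 0 then 0 else iexp (- (t * x)) * char M t"
    have "((\<lambda>x. CLINT t|lborel. ?K x t) has_vector_derivative (CLINT t|lborel. ?K' x t)) (at x)"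
    proof (rule has_vector_derivative_lebesgue_integral(2)[where e = 1 and w = "\<lambda>t. norm (char M t)"])
      show "((\<lambda>x. ?K x t) has_vector_derivative ?K' s t) (at s)" for s t
        by (cases "t = 0")
           (auto intro!: derivative_eq_intros has_vector_derivative_real_field simp: field_simps)
    qed (use Kint int in \<open>auto simp: norm_mult\<close>)
    moreover have "(CLINT t|lborel. ?K' x t) = (CLINT t|lborel. iexp (- (t * x)) * char M t)"
    proof (rule integral_cong_AE)
      show "AE t in lborel. ?K' x t = iexp (- (t * x)) * char M t"
        using AE_lborel_singleton[of 0] by eventually_elim simp
    qed auto
    ultimately have "((\<lambda>x. CLINT t|lborel. ?K x t) has_vector_derivative (CLINT t|lborel. iexp (- (t * x)) * char M t)) (at x)"
      by (simp only:)
    then show ?thesis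
      unfolding Q_def[abs_def] inv_fourier_def by (rule has_vector_derivative_mult_right)
  qed
  define D where "D x = cdf M x - Re (Q x)" for x
  have eq: "D a = D b" if "a < b" "measure M {a} = 0" "measure M {b} = 0" for a b
  proof -
    let ?F = "\<lambda>t. (iexp (- (t * a)) - iexp (- (t * b))) / (\<i> * complex_of_real t) * char M t"
    \<comment> \<open>The inversion formula yields a limit of truncated integrals; as the integrand
      is absolutely integrable, the limit is the full integral.\<close>
    have "(\<lambda>T::nat. CLBINT t=real_of_int (- int T)..real T. ?F t) \<longlonglongrightarrow> (CLINT t|lborel. ?F t)"
    proof -
      have "(\<lambda>T::nat. CLINT t|lborel. indicat_real {- real T<..<real T} t *\<^sub>R ?F t) \<longlonglongrightarrow> (CLINT t|lborel. ?F t)"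
      proof (rule integral_dominated_convergence[where w = "\<lambda>t. norm (?F t)"])
        show "AE t in lborel. (\<lambda>T. indicat_real {- real T<..<real T} t *\<^sub>R ?F t) \<longlonglongrightarrow> ?F t"
        proof (rule AE_I2)
          fix t :: real
          have "\<forall>\<^sub>F T in sequentially. \<bar>t\<bar> < real T"
            using filterlim_real_sequentially by (auto simp: filterlim_at_top_dense)
          then have "\<forall>\<^sub>F T in sequentially. indicat_real {- real T<..<real T} t *\<^sub>R ?F t = ?F t"
            by eventually_elim (auto split: split_indicator)
          then show "(\<lambda>T. indicat_real {- real T<..<real T} t *\<^sub>R ?F t) \<longlonglongrightarrow> ?F t"
            by (rule tendsto_eventually)
        qed
        show "AE t in lborel. norm (indicat_real {- real T<..<real T} t *\<^sub>R ?F t) \<le> norm (?F t)" for T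
          by (auto split: split_indicator)
      qed (use Kint2[of a b] in auto)
      then show ?thesis
        by (simp add: interval_lebesgue_integral_def set_lebesgue_integral_def)
    qed
    then have "(\<lambda>T::nat. 1 / (2 * pi) * (CLBINT t=real_of_int (- int T)..real T. ?F t)) \<longlonglongrightarrow> 1 / (2 * pi) * (CLINT t|lborel. ?F t)"
      by (intro tendsto_mult tendsto_const)
    from LIMSEQ_unique[OF this Levy_Inversion[of a b]] that
    have "complex_of_real (measure M {a<..b}) = 1 / (2 * pi) * (CLINT t|lborel. ?F t)" by simp
    also have "(CLINT t|lborel. ?F t) = (CLINT t|lborel. ?K b t - ?K a t)"
      by (intro Bochner_Integration.integral_cong) (auto simp: field_simps diff_divide_distrib)
    also have "\<dots> = (CLINT t|lborel. ?K b t) - (CLINT t|lborel. ?K a t)"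
      by (rule Bochner_Integration.integral_diff) (rule Kint)+
    finally have "complex_of_real (measure M {a<..b}) = Q b - Q a" by (simp add: Q_def algebra_simps)
    then have "measure M {a<..b} = Re (Q b) - Re (Q a)" by (metis Re_complex_of_real minus_complex.sel(1))
    then show ?thesis using cdf_diff_eq[OF that(1)] by (simp add: D_def)
  qed
  have ct: "countable {x. measure M {x} \<noteq> 0}" by (rule countable_support)
  obtain c where c: "measure M {c} = 0" using open_minus_countable[OF ct, of UNIV] by auto
  have const: "D x = D c" for x
  proof (rule ccontr)
    assume ne: "D x \<noteq> D c"
    have "(\<lambda>x. Re (Q x)) \<midarrow>x\<rightarrow> Re (Q x)"
      by (rule DERIV_isCont[OF has_field_derivative_Re[OF deriv], unfolded isCont_def])
    then have "(D \<longlongrightarrow> D x) (at_right x)"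
      unfolding D_def[abs_def] using cdf_is_right_cont[of x] tendsto_within_subset[OF _ subset_UNIV]
      by (intro tendsto_diff) (simp_all add: continuous_within)
    \<comment> \<open>If \<open>D x\<close> differed from \<open>D c\<close>, so would
      \<open>D\<close> throughout some interval to the right of x, which nevertheless contains a
      point without mass.\<close>
    then have "\<forall>\<^sub>F y in at_right x. D y \<noteq> D c" using ne by (rule tendsto_imp_eventually_ne)
    then obtain N where N: "N > x" "\<And>y. x < y \<Longrightarrow> y < N \<Longrightarrow> D y \<noteq> D c"
      unfolding eventually_at_right[OF less_add_one] by auto
    obtain y where y: "x < y" "y < N" "measure M {y} = 0"
      using open_minus_countable[OF ct, of "{x<..<N}"] N(1) by auto
    have "D y = D c"
      using eq[OF _ y(3) c] eq[OF _ c y(3)] by (cases y c rule: linorder_cases) (blast, blast, metis)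
    then show False using N(2)[OF y(1,2)] by contradiction
  qed
  have "cdf M = (\<lambda>x. Re (Q x) + D c)" using const by (auto simp: D_def fun_eq_iff algebra_simps)
  then show ?thesis using deriv[of x] by (auto intro!: derivative_eq_intros)
qed

lemma (in real_distribution) inv_fourier_char_density:
  assumes int: "integrable lborel (char M)"
  shows "0 \<le> Re (inv_fourier (char M) x)"
    and "M = density lborel (\<lambda>x. ennreal (Re (inv_fourier (char M) x)))"
proof -
  let ?p = "\<lambda>x. Re (inv_fourier (char M) x)"
  note D = has_real_derivative_cdf[OF int]
  show nonneg: "0 \<le> ?p x" for x
  proof (rule mono_on_imp_deriv_nonneg[OF _ D])
    show "mono_on UNIV (cdf M)" by (auto intro!: mono_onI cdf_nondecreasing)
  qed auto
  have "continuous_on UNIV ?p"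
    using isCont_inv_fourier[OF int] by (auto intro!: continuous_at_imp_continuous_on continuous_intros)
  then have [measurable]: "?p \<in> borel_measurable borel" by (rule borel_measurable_continuous_onI)
  show "M = density lborel (\<lambda>x. ennreal (?p x))"
  proof (rule measure_eqI_lessThan)
    show "emeasure M {x<..} < \<infinity>" for x by (simp add: less_top[symmetric])
    show "emeasure M {x<..} = emeasure (density lborel (\<lambda>x. ennreal (?p x))) {x<..}" for x
    proof -
      have "{x<..} = space M - {..x}" by auto
      then have "measure M {x<..} = 1 - cdf M x" unfolding cdf_def by (metis prob_compl sets_M atMost_borel)
      then have "emeasure M {x<..} = ennreal (1 - cdf M x)" by (simp add: emeasure_eq_measure)
      \<comment> \<open>The fundamental theorem on the closed half-line, using that the distribution
        function tends to 1; the end point is then dropped as a null set.\<close>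
      also have "\<dots> = (\<integral>\<^sup>+y. ennreal (?p y) * indicator {x..} y \<partial>lborel)"
        by (rule nn_integral_FTC_atLeast[symmetric]) (auto intro: D nonneg cdf_lim_at_top_prob)
      also have "\<dots> = (\<integral>\<^sup>+y. ennreal (?p y) * indicator {x<..} y \<partial>lborel)"
        using AE_lborel_singleton[of x]
        by (intro nn_integral_cong_AE) (auto elim!: eventually_mono split: split_indicator)
      finally show ?thesis by (simp add: emeasure_density)
    qed
  qed auto
qed

section \<open>Characteristic functions of Levy processes\<close>

context
  fixes M :: "'a measure" and X :: "real \<Rightarrow> 'a \<Rightarrow> real"
  assumes L: "levy_process M X"
begin

interpretation prob_space M using L by (simp add: levy_process_def)

lemma levy_process_measurable: "t \<ge> 0 \<Longrightarrow> X t \<in> borel_measurable M"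
  using L by (simp add: levy_process_def)

lemma levy_process_real_distribution: "t \<ge> 0 \<Longrightarrow> real_distribution (distr M borel (X t))"
  by (simp add: levy_process_measurable real_distribution_distr)

text \<open>The increments over a grid of step h are independent copies of \<open>X h\<close> and
  telescope to \<open>X (real n * h)\<close>, almost surely, as the process starts at 0.\<close>

lemma char_levy_process_mult:
  assumes h: "h \<ge> 0"
  shows "char (distr M borel (X (real n * h))) x = char (distr M borel (X h)) x ^ n"
proof -
  note [measurable] = levy_process_measurable
  let ?\<tau> = "\<lambda>i. real i * h"
  let ?Y = "\<lambda>i \<omega>. X (?\<tau> (Suc i)) \<omega> - X (?\<tau> i) \<omega>"
  have "0 \<le> ?\<tau> 0 \<and> mono ?\<tau>" using h by (auto simp: mono_def intro: mult_right_mono)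
  moreover have "\<forall>(n::nat) (\<tau>::nat \<Rightarrow> real). 0 \<le> \<tau> 0 \<and> mono \<tau> \<longrightarrow>
      indep_vars (\<lambda>_. borel) (\<lambda>i \<omega>. X (\<tau> (Suc i)) \<omega> - X (\<tau> i) \<omega>) {..<n}"
    using L unfolding levy_process_def by (elim conjE)
  ultimately have ind: "indep_vars (\<lambda>_. borel) ?Y {..<n}" by (elim allE[of _ n] allE[of _ ?\<tau>] mp)
  have inc: "distr M borel (?Y i) = distr M borel (X h)" for i
  proof -
    have "\<forall>s\<ge>0. \<forall>t\<ge>0. distr M borel (\<lambda>\<omega>. X (s + t) \<omega> - X s \<omega>) = distr M borel (X t)"
      using L unfolding levy_process_def by blast
    from this[rule_format, of "real i * h" h] h show ?thesis by (simp add: algebra_simps)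
  qed
  have "AE \<omega> in M. X 0 \<omega> = 0" using L unfolding levy_process_def by blast
  then have "AE \<omega> in M. X (real n * h) \<omega> = (\<Sum>i<n. ?Y i \<omega>)"
  proof eventually_elim
    case (elim \<omega>)
    then show ?case using sum_lessThan_telescope[of "\<lambda>i. X (?\<tau> i) \<omega>" n] by simp
  qed
  then have "distr M borel (X (real n * h)) = distr M borel (\<lambda>\<omega>. \<Sum>i<n. ?Y i \<omega>)"
    using h by (intro distr_cong_AE) auto
  then have "char (distr M borel (X (real n * h))) x = (\<Prod>i<n. char (distr M borel (?Y i)) x)"
    by (simp only: char_distr_sum[OF ind])
  then show ?thesis unfolding inc by simp
qed

lemma char_levy_process_continuous:
  assumes t: "t \<ge> 0"
  shows "((\<lambda>s. char (distr M borel (X s)) x) \<longlongrightarrow> char (distr M borel (X t)) x) (at t within {0..})"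
proof (rule tendstoI)
  fix e :: real assume e: "e > 0"
  note [measurable] = levy_process_measurable
  \<comment> \<open>Small increments contribute at most e / 4 and the exceptional event at most 2 e
    / 4, which leaves a margin below e. Adding 1 in the denominator covers x = 0.\<close>
  define \<epsilon> where "\<epsilon> = e / (4 * (\<bar>x\<bar> + 1))"
  have \<epsilon>: "\<epsilon> > 0" "\<bar>x\<bar> * \<epsilon> \<le> e / 4" using e
    by (auto simp: \<epsilon>_def field_simps)
  let ?A = "\<lambda>s. {\<omega> \<in> space M. \<bar>X s \<omega> - X t \<omega>\<bar> > \<epsilon>}"
  have "((\<lambda>s. measure M (?A s)) \<longlongrightarrow> 0) (at t within {0..})"
    using L t \<epsilon>(1) unfolding levy_process_def by blast
  then have "\<forall>\<^sub>F s in at t within {0..}. measure M (?A s) < e / 4"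
    using e by (intro order_tendstoD) auto
  moreover have "\<forall>\<^sub>F s in at t within {0..}. s \<ge> 0" by (simp add: eventually_at_filter)
  ultimately show "\<forall>\<^sub>F s in at t within {0..}. dist (char (distr M borel (X s)) x) (char (distr M borel (X t)) x) < e"
  proof eventually_elim
    case (elim s)
    note [measurable] = levy_process_measurable[OF elim(2)] levy_process_measurable[OF t]
    have A: "?A s \<in> events" by measurable
    have int: "integrable M (\<lambda>\<omega>. iexp (x * X s \<omega>))" "integrable M (\<lambda>\<omega>. iexp (x * X t \<omega>))"
      by (intro integrable_const_bound[where B = 1]; simp)+
    have "char (distr M borel (X s)) x - char (distr M borel (X t)) x = (CLINT \<omega>|M. iexp (x * X s \<omega>) - iexp (x * X t \<omega>))"
      using int by (simp add: char_def integral_distr)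
    also have "norm \<dots> \<le> (LINT \<omega>|M. \<bar>x\<bar> * \<epsilon> + 2 * indicator (?A s) \<omega>)"
    proof (rule order_trans[OF integral_norm_bound integral_mono])
      fix \<omega> assume \<omega>: "\<omega> \<in> space M"
      have "iexp (x * X s \<omega>) - iexp (x * X t \<omega>) = iexp (x * X t \<omega>) * (iexp (x * (X s \<omega> - X t \<omega>)) - 1)"
        by (simp add: algebra_simps exp_diff exp_minus)
      then have eq: "norm (iexp (x * X s \<omega>) - iexp (x * X t \<omega>)) = norm (iexp (x * (X s \<omega> - X t \<omega>)) - 1)"
        by (simp only: norm_mult norm_exp_i_times mult_1)
      have "norm (iexp (x * (X s \<omega> - X t \<omega>)) - 1) \<le> \<bar>x\<bar> * \<bar>X s \<omega> - X t \<omega>\<bar>"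
        "norm (iexp (x * (X s \<omega> - X t \<omega>)) - 1) \<le> 2"
        using iexp_approx1[of "x * (X s \<omega> - X t \<omega>)" 0] iexp_approx2[of "x * (X s \<omega> - X t \<omega>)" 0]
        by (auto simp: abs_mult)
      moreover have "0 \<le> \<bar>x\<bar> * \<epsilon>" using \<epsilon>(1) by simp
      moreover have "\<bar>x\<bar> * \<bar>X s \<omega> - X t \<omega>\<bar> \<le> \<bar>x\<bar> * \<epsilon>" if "\<omega> \<notin> ?A s"
        using that \<omega> by (intro mult_left_mono) auto
      ultimately show "norm (iexp (x * X s \<omega>) - iexp (x * X t \<omega>)) \<le> \<bar>x\<bar> * \<epsilon> + 2 * indicator (?A s) \<omega>"
        unfolding eq by (cases "\<omega> \<in> ?A s") auto
    next
      show "integrable M (\<lambda>\<omega>. \<bar>x\<bar> * \<epsilon> + 2 * indicator (?A s) \<omega>)"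
        by (intro Bochner_Integration.integrable_add integrable_mult_right integrable_const integrable_real_indicator A)
           (simp add: less_top[symmetric])
    qed (use int in auto)
    also have "\<dots> = \<bar>x\<bar> * \<epsilon> + 2 * measure M (?A s)"
    proof -
      have "integrable M (indicat_real (?A s))"
        by (rule integrable_real_indicator[OF A]) (simp add: less_top[symmetric])
      moreover have "?A s \<inter> space M = ?A s" by auto
      ultimately show ?thesis by (simp add: prob_space)
    qed
    also have "\<dots> < e" using \<epsilon>(2) elim(1) e by linarith
    finally show ?case by (simp add: dist_norm)
  qed
qed

text \<open>The \<open>m\<close>-th root of the characteristic function of \<open>X 1\<close> given by \<open>X (1 / m)\<close> and the one given by
  \<open>\<psi> / m\<close> differ by a continuous function of \<open>x\<close> with values in the roots of unity, which is constant.\<close>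

lemma char_levy_process:
  assumes X1: "\<And>x. char (distr M borel (X 1)) x = exp (\<psi> x)"
    and cont: "continuous_on UNIV \<psi>" and \<psi>0: "\<psi> 0 = 0" and t: "t \<ge> 0"
  shows "char (distr M borel (X t)) x = exp (t *\<^sub>R \<psi> x)"
proof -
  have root: "char (distr M borel (X (1 / real m))) x = exp (\<psi> x / of_nat m)" if m: "m > 0" for m x
  proof -
    interpret R: real_distribution "distr M borel (X (1 / real m))"
      by (rule levy_process_real_distribution) simp
    define f where "f x = char (distr M borel (X (1 / real m))) x * exp (- (\<psi> x / of_nat m))" for x
    have f1: "f x ^ m = 1" for x
    proof -
      have "char (distr M borel (X (1 / real m))) x ^ m = exp (\<psi> x)"
        using char_levy_process_mult[of "1 / real m" m x] X1[of x] m by simp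
      moreover have "exp (- (\<psi> x / of_nat m)) ^ m = exp (- \<psi> x)"
        unfolding exp_of_nat_mult[symmetric] using m by simp
      ultimately have "f x ^ m = exp (\<psi> x) * exp (- \<psi> x)" by (simp only: f_def power_mult_distrib)
      also have "\<dots> = 1" by (simp add: exp_minus)
      finally show ?thesis .
    qed
    have "f constant_on UNIV"
    proof (rule continuous_finite_range_constant)
      show "continuous_on UNIV f" unfolding f_def
        by (intro continuous_intros cont continuous_at_imp_continuous_on ballI R.isCont_char) (use m in auto)
      have "f ` UNIV \<subseteq> {z. z ^ m = 1}" using f1 by auto
      then show "finite (f ` UNIV)" by (rule finite_subset) (use m in \<open>intro finite_roots_unity, simp\<close>)
    qed auto
    \<comment> \<open>At frequency 0 both factors are 1, because \<psi> vanishes there; this fixes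
      which root of unity occurs.\<close>
    then have "f x = f 0" by (metis UNIV_I constant_on_def)
    also have "f 0 = 1" by (simp add: f_def \<psi>0 R.char_zero)
    finally show ?thesis by (simp add: f_def exp_minus field_simps)
  qed
  \<comment> \<open>Rational approximation of t from above, which keeps all times nonnegative and
    lets continuity of the process pass to the limit.\<close>
  define u where "u n = real (nat \<lceil>t * real (Suc n)\<rceil>) * (1 / real (Suc n))" for n
  have u: "char (distr M borel (X (u n))) x = exp (u n *\<^sub>R \<psi> x)" for n
  proof -
    have "char (distr M borel (X (u n))) x = exp (\<psi> x / of_nat (Suc n)) ^ nat \<lceil>t * real (Suc n)\<rceil>"
      unfolding u_def root[OF zero_less_Suc, of n x, symmetric] by (rule char_levy_process_mult) simp
    also have "\<dots> = exp (of_nat (nat \<lceil>t * real (Suc n)\<rceil>) * (\<psi> x / of_nat (Suc n)))" by (simp only: exp_of_nat_mult)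
    also have "\<dots> = exp (u n *\<^sub>R \<psi> x)" by (simp add: u_def scaleR_conv_of_real)
    finally show ?thesis .
  qed
  have ub: "t \<le> u n" "u n \<le> t + 1 / real (Suc n)" for n
  proof -
    have "t * real (Suc n) \<le> real (nat \<lceil>t * real (Suc n)\<rceil>)" "real (nat \<lceil>t * real (Suc n)\<rceil>) \<le> t * real (Suc n) + 1"
    proof -
      have "0 \<le> t * real (Suc n)" using t by simp
      then have "0 \<le> \<lceil>t * real (Suc n)\<rceil>" by linarith
      then show "t * real (Suc n) \<le> real (nat \<lceil>t * real (Suc n)\<rceil>)"
        "real (nat \<lceil>t * real (Suc n)\<rceil>) \<le> t * real (Suc n) + 1" by linarith+
    qed
    then show "t \<le> u n" "u n \<le> t + 1 / real (Suc n)"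
      by (simp_all only: u_def times_divide_eq_right mult_1_right pos_le_divide_eq pos_divide_le_eq
          of_nat_0_less_iff zero_less_Suc distrib_right times_divide_eq_left nonzero_mult_div_cancel_right
          of_nat_eq_0_iff nat.distinct simp_thms)
  qed
  have "(\<lambda>n. t + 1 / real (Suc n)) \<longlonglongrightarrow> t + 0"
    by (intro tendsto_add tendsto_const LIMSEQ_Suc[OF lim_1_over_n])
  then have ul: "u \<longlonglongrightarrow> t"
    by (intro tendsto_sandwich[of "\<lambda>_. t" u sequentially "\<lambda>n. t + 1 / real (Suc n)"] eventuallyI ub)
       (simp_all only: tendsto_const add_0_right)
  have "continuous_on {0..} (\<lambda>s. char (distr M borel (X s)) x)"
    unfolding continuous_on_def using char_levy_process_continuous by auto
  then have "(\<lambda>n. char (distr M borel (X (u n))) x) \<longlonglongrightarrow> char (distr M borel (X t)) x"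
    by (rule continuous_on_tendsto_compose[OF _ ul]) (use t order_trans[OF t ub(1)] in auto)
  moreover have "(\<lambda>n. exp (u n *\<^sub>R \<psi> x)) \<longlonglongrightarrow> exp (t *\<^sub>R \<psi> x)" by (rule tendsto_exp[OF tendsto_scaleR[OF ul tendsto_const]])
  ultimately show ?thesis unfolding u by (rule LIMSEQ_unique)
qed

end

section \<open>Semi-fractional derivatives as Fourier multipliers\<close>

lemma (in pair_sigma_finite) integrable_pair_bound:
  fixes f :: "'a \<times> 'b \<Rightarrow> 'c::{banach, second_countable_topology}" and v :: "'a \<Rightarrow> real" and w :: "'b \<Rightarrow> real"
  assumes f: "f \<in> borel_measurable (M1 \<Otimes>\<^sub>M M2)" and v: "integrable M1 v" and w: "integrable M2 w"
    and le: "\<And>x y. norm (f (x, y)) \<le> v x * w y"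
  shows "integrable (M1 \<Otimes>\<^sub>M M2) f"
proof (rule Bochner_Integration.integrable_bound[OF _ f])
  have [measurable]: "v \<in> borel_measurable M1" "w \<in> borel_measurable M2" using v w by auto
  show "integrable (M1 \<Otimes>\<^sub>M M2) (\<lambda>(x, y). v x * w y)"
    by (rule Fubini_integrable) (use v w in \<open>auto simp: abs_mult\<close>)
  show "AE p in M1 \<Otimes>\<^sub>M M2. norm (f p) \<le> norm (case p of (x, y) \<Rightarrow> v x * w y)"
    using le by (intro AE_I2) (auto intro: order_trans[OF _ abs_ge_self])
qed

context
  fixes g :: "real \<Rightarrow> complex"
  assumes g[measurable]: "g \<in> borel_measurable borel"
    and g2: "integrable lborel (\<lambda>k. (1 + k\<^sup>2) * norm (g k))"
begin

lemma integrable_mult_quadratic: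
  assumes [measurable]: "h \<in> borel_measurable borel" and h: "\<And>k. norm (h k) \<le> K * (1 + k\<^sup>2)"
  shows "integrable lborel (\<lambda>k. h k * g k)"
proof (rule Bochner_Integration.integrable_bound)
  show "integrable lborel (\<lambda>k. K * ((1 + k\<^sup>2) * norm (g k)))" using g2 by (rule integrable_mult_right)
  have "norm (h k * g k) \<le> K * ((1 + k\<^sup>2) * norm (g k))" for k
    using mult_right_mono[OF h[of k] norm_ge_zero[of "g k"]] by (simp add: norm_mult ac_simps)
  then show "AE k in lborel. norm (h k * g k) \<le> norm (K * ((1 + k\<^sup>2) * norm (g k)))"
    by (intro AE_I2) (auto intro: order_trans[OF _ abs_ge_self])
qed measurable

lemma integrable_of_quadratic: "integrable lborel g"
  using integrable_mult_quadratic[of "\<lambda>_. 1" 1] by simp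

lemma has_real_derivative_Re_inv_fourier:
  "((\<lambda>x. Re (inv_fourier g x)) has_real_derivative Re (inv_fourier (\<lambda>k. - \<i> * k * g k) x)) (at x)"
proof (rule has_field_derivative_Re[OF has_vector_derivative_inv_fourier])
  have "integrable lborel (\<lambda>k. complex_of_real k * g k)"
    by (rule integrable_mult_quadratic[where K = 1]) (auto simp: abs_le_one_plus_square)
  from integrable_norm[OF this] have "integrable lborel (\<lambda>k. \<bar>k * norm (g k)\<bar>)"
    by (simp add: norm_mult abs_mult)
  then show "integrable lborel (\<lambda>k. k * norm (g k))"
    by (rule integrable_abs_cancel) auto
qed (rule integrable_of_quadratic)

text \<open>A shift of x by - y multiplies the transform by exp (\<i> k y), and a derivative in x
  multiplies it by - \<i> k. So each integrand of the semi-fractional derivatives has, up to sign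
  and reflection of y, the kernel as its multiplier.\<close>

lemma Re_inv_fourier_levy_kernel:
  defines "u \<equiv> \<lambda>x. Re (inv_fourier g x)"
  shows "u (x - y) - u x + compensator \<alpha> y * deriv u x = Re (inv_fourier (\<lambda>k. levy_kernel \<alpha> k y * g k) x)"
proof -
  let ?D = "\<lambda>k. - \<i> * complex_of_real k * g k"
  have int1: "integrable lborel (\<lambda>k. iexp (k * y) * g k)"
    by (rule integrable_mult_quadratic[where K = 1]) auto
  have int2: "integrable lborel (\<lambda>k. (- 1) * g k)" using integrable_of_quadratic by simp
  have int3: "integrable lborel (\<lambda>k. complex_of_real (compensator \<alpha> y) * ?D k)"
    by (intro integrable_mult_right integrable_mult_quadratic[where K = 1])
       (auto simp: norm_mult abs_le_one_plus_square)
  have "inv_fourier (\<lambda>k. levy_kernel \<alpha> k y * g k) x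
      = inv_fourier (\<lambda>k. (iexp (k * y) * g k + (- 1) * g k) + complex_of_real (compensator \<alpha> y) * ?D k) x"
    by (intro arg_cong[where f = "\<lambda>h. inv_fourier h x"]) (auto simp: levy_kernel_def algebra_simps)
  also have "\<dots> = inv_fourier (\<lambda>k. iexp (k * y) * g k) x + (- 1) * inv_fourier g x
      + complex_of_real (compensator \<alpha> y) * inv_fourier ?D x"
    using int1 int2 int3 by (simp only: inv_fourier_add Bochner_Integration.integrable_add inv_fourier_mult)
  also have "inv_fourier (\<lambda>k. iexp (k * y) * g k) x = inv_fourier g (x - y)"
    unfolding inv_fourier_def
  proof (rule arg_cong2[where f = "(*)", OF refl Bochner_Integration.integral_cong[OF refl]])
    fix k
    have "iexp (- (k * (x - y))) = iexp (- (k * x)) * iexp (k * y)"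
      by (simp add: algebra_simps flip: exp_add)
    then show "iexp (- (k * x)) * (iexp (k * y) * g k) = iexp (- (k * (x - y))) * g k"
      by (simp only: mult.assoc)
  qed
  finally show ?thesis
    using DERIV_imp_deriv[OF has_real_derivative_Re_inv_fourier, of x] by (simp add: u_def)
qed

text \<open>The separated bound makes the double integral over frequencies and jumps absolutely
  convergent. The sign \<epsilon> treats both directions together and leaves that bound unchanged,
  since only k^2 occurs in it.\<close>

lemma set_integral_inv_fourier_levy_kernel:
  fixes \<epsilon> :: real
  assumes \<mu>: "sigma_finite_measure \<mu>" "sets \<mu> = sets borel"
    and G: "set_integrable \<mu> {0<..} (kernel_bound \<alpha>)" and \<epsilon>: "\<epsilon>\<^sup>2 = 1"
  shows "set_integrable \<mu> {0<..} (\<lambda>y. Re (inv_fourier (\<lambda>k. levy_kernel \<alpha> (\<epsilon> * k) y * g k) x))"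
    and "(LINT y:{0<..}|\<mu>. Re (inv_fourier (\<lambda>k. levy_kernel \<alpha> (\<epsilon> * k) y * g k) x))
      = Re (inv_fourier (\<lambda>k. symbol \<alpha> \<mu> (\<epsilon> * k) * g k) x)"
proof -
  interpret sigma_finite_measure \<mu> by (rule \<mu>(1))
  interpret P: pair_sigma_finite lborel \<mu> ..
  note [measurable_cong] = \<mu>(2)
  let ?F = "\<lambda>k y. indicat_real {0<..} y *\<^sub>R (iexp (- (k * x)) * (levy_kernel \<alpha> (\<epsilon> * k) y * g k))"
  have F: "integrable (lborel \<Otimes>\<^sub>M \<mu>) (case_prod ?F)"
  proof (rule P.integrable_pair_bound)
    show "integrable lborel (\<lambda>k. 3 * ((1 + k\<^sup>2) * norm (g k)))" using g2 by (rule integrable_mult_right)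
    show "integrable \<mu> (\<lambda>y. indicator {0<..} y *\<^sub>R kernel_bound \<alpha> y)" using G by (simp only: set_integrable_def)
    have "norm (levy_kernel \<alpha> (\<epsilon> * k) y * g k) \<le> 3 * ((1 + k\<^sup>2) * norm (g k)) * kernel_bound \<alpha> y" for k y
      using mult_right_mono[OF norm_levy_kernel_le[of \<alpha> "\<epsilon> * k" y] norm_ge_zero[of "g k"]] \<epsilon>
      by (simp add: norm_mult power_mult_distrib algebra_simps)
    then show "norm (case_prod ?F (k, y)) \<le> 3 * ((1 + k\<^sup>2) * norm (g k)) * (indicator {0<..} y *\<^sub>R kernel_bound \<alpha> y)" for k y
      by (auto simp: norm_mult split: split_indicator)
  qed measurable
  have 1: "indicat_real {0<..} y *\<^sub>R Re (inv_fourier (\<lambda>k. levy_kernel \<alpha> (\<epsilon> * k) y * g k) x)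
      = Re (complex_of_real (1 / (2 * pi)) * (CLINT k|lborel. ?F k y))" for y
    by (auto simp: inv_fourier_def split: split_indicator)
  have int: "integrable \<mu> (\<lambda>y. complex_of_real (1 / (2 * pi)) * (CLINT k|lborel. ?F k y))"
    by (intro integrable_mult_right P.integrable_snd F)
  show "set_integrable \<mu> {0<..} (\<lambda>y. Re (inv_fourier (\<lambda>k. levy_kernel \<alpha> (\<epsilon> * k) y * g k) x))"
    unfolding set_integrable_def 1 by (rule integrable_Re[OF int])
  have "(LINT y:{0<..}|\<mu>. Re (inv_fourier (\<lambda>k. levy_kernel \<alpha> (\<epsilon> * k) y * g k) x))
      = Re (CLINT y|\<mu>. complex_of_real (1 / (2 * pi)) * (CLINT k|lborel. ?F k y))"
    unfolding set_lebesgue_integral_def 1 by (rule integral_Re[OF int])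
  also have "(CLINT y|\<mu>. complex_of_real (1 / (2 * pi)) * (CLINT k|lborel. ?F k y))
      = complex_of_real (1 / (2 * pi)) * (CLINT k|lborel. (CLINT y|\<mu>. ?F k y))"
    by (simp only: integral_mult_right_zero P.Fubini_integral[OF F])
  also have "(CLINT k|lborel. (CLINT y|\<mu>. ?F k y)) = (CLINT k|lborel. iexp (- (k * x)) * (symbol \<alpha> \<mu> (\<epsilon> * k) * g k))"
  proof (rule Bochner_Integration.integral_cong[OF refl])
    fix k
    have "(CLINT y|\<mu>. ?F k y) = (CLINT y|\<mu>. (iexp (- (k * x)) * g k) * (indicat_real {0<..} y *\<^sub>R levy_kernel \<alpha> (\<epsilon> * k) y))"
      by (rule Bochner_Integration.integral_cong) (auto simp: ac_simps)
    then show "(CLINT y|\<mu>. ?F k y) = iexp (- (k * x)) * (symbol \<alpha> \<mu> (\<epsilon> * k) * g k)"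
      by (simp only: integral_mult_right_zero symbol_def set_lebesgue_integral_def ac_simps)
  qed
  finally show "(LINT y:{0<..}|\<mu>. Re (inv_fourier (\<lambda>k. levy_kernel \<alpha> (\<epsilon> * k) y * g k) x))
      = Re (inv_fourier (\<lambda>k. symbol \<alpha> \<mu> (\<epsilon> * k) * g k) x)"
    by (simp add: inv_fourier_def)
qed

lemma semifrac_inv_fourier:
  fixes x :: real
  defines "u \<equiv> \<lambda>x. Re (inv_fourier g x)"
  assumes \<mu>: "sigma_finite_measure (phi_measure \<alpha> \<theta>)" "sets (phi_measure \<alpha> \<theta>) = sets borel"
    and G: "set_integrable (phi_measure \<alpha> \<theta>) {0<..} (kernel_bound \<alpha>)"
  shows "has_semifrac_pos \<alpha> \<theta> u x" and "has_semifrac_neg \<alpha> \<theta> u x"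
    and "semifrac_pos \<alpha> \<theta> u x = (if \<alpha> < 1 then - 1 else 1) * Re (inv_fourier (\<lambda>k. symbol \<alpha> (phi_measure \<alpha> \<theta>) k * g k) x)"
    and "semifrac_neg \<alpha> \<theta> u x = (if \<alpha> < 1 then - 1 else 1) * Re (inv_fourier (\<lambda>k. symbol \<alpha> (phi_measure \<alpha> \<theta>) (- k) * g k) x)"
proof -
  \<comment> \<open>For \<alpha> < 1 the operators subtract the shifted value from f x, the reverse
    of the order in the kernel.\<close>
  let ?\<sigma> = "if \<alpha> < 1 then - 1 else 1 :: real"
  let ?P = "\<lambda>\<epsilon> y. Re (inv_fourier (\<lambda>k. levy_kernel \<alpha> (\<epsilon> * k) y * g k) x)"
  have diff: "u differentiable (at x)"
    unfolding u_def using has_real_derivative_Re_inv_fourier real_differentiable_def by blast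
  have pos: "semifrac_integrand_pos \<alpha> u x = (\<lambda>y. ?\<sigma> * ?P 1 y)"
    using Re_inv_fourier_levy_kernel[of x _ \<alpha>] unfolding u_def
    by (auto simp: fun_eq_iff semifrac_integrand_pos_def compensator_def algebra_simps)
  \<comment> \<open>The integrand in the negative direction is the positive one at - y, because the
    compensator is odd.\<close>
  have neg: "semifrac_integrand_neg \<alpha> u x = (\<lambda>y. ?\<sigma> * ?P (- 1) y)"
    using Re_inv_fourier_levy_kernel[of x "- _" \<alpha>] unfolding u_def
    by (auto simp: fun_eq_iff semifrac_integrand_neg_def compensator_def levy_kernel_minus algebra_simps)
  note I = set_integral_inv_fourier_levy_kernel[OF \<mu> G, where x = x]
  show "has_semifrac_pos \<alpha> \<theta> u x" "has_semifrac_neg \<alpha> \<theta> u x"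
    unfolding has_semifrac_pos_def has_semifrac_neg_def pos neg
    using diff I(1)[of 1] I(1)[of "- 1"] by (auto intro!: set_integrable_mult_right simp del: mult_minus_left)
  show "semifrac_pos \<alpha> \<theta> u x = ?\<sigma> * Re (inv_fourier (\<lambda>k. symbol \<alpha> (phi_measure \<alpha> \<theta>) k * g k) x)"
    unfolding semifrac_pos_def pos set_integral_mult_right using I(2)[of 1] by simp
  show "semifrac_neg \<alpha> \<theta> u x = ?\<sigma> * Re (inv_fourier (\<lambda>k. symbol \<alpha> (phi_measure \<alpha> \<theta>) (- k) * g k) x)"
    unfolding semifrac_neg_def neg set_integral_mult_right using I(2)[of "- 1"] by simp
qed

end

section \<open>Decay of exp (t \<psi>) and differentiation in time\<close>

lemma integrable_quadratic_exp_decay: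
  fixes \<alpha> s :: real
  assumes \<alpha>: "\<alpha> > 0" and s: "s > 0"
  shows "integrable lborel (\<lambda>k. (1 + k\<^sup>2) * exp (- (s * \<bar>k\<bar> powr \<alpha>)))"
proof -
  \<comment> \<open>The Taylor term of order n of the exponential then grows at least like k^4 for
    \<bar>k\<bar> \<ge> 1. This beats (1 + k^2)^2 and leaves the integrable function 1 / (1 +
    k^2).\<close>
  obtain n :: nat where n: "4 / \<alpha> \<le> real n" using real_arch_simple by blast
  \<comment> \<open>The summand 4 covers \<bar>k\<bar> \<le> 1; the other one comes from (1 + k^2)^2
    \<le> 4 k^4 beyond and the coefficient s^n / n! of the Taylor term.\<close>
  define B where "B = 4 + 4 * fact n / s ^ n"
  have B: "(1 + k\<^sup>2)\<^sup>2 \<le> B * exp (s * \<bar>k\<bar> powr \<alpha>)" for k :: real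
  proof (cases "\<bar>k\<bar> \<le> 1")
    case True
    then have "(1 + k\<^sup>2)\<^sup>2 \<le> 2\<^sup>2" by (intro power_mono) (auto simp: abs_square_le_1)
    also have "\<dots> \<le> B * 1" using s by (simp add: B_def)
    also have "\<dots> \<le> B * exp (s * \<bar>k\<bar> powr \<alpha>)" using s by (intro mult_left_mono) (auto simp: B_def)
    finally show ?thesis .
  next
    case False
    then have k: "1 \<le> \<bar>k\<bar>" by simp
    then have "1 \<le> k\<^sup>2" using one_le_power[of "\<bar>k\<bar>" 2] by simp
    then have "(1 + k\<^sup>2)\<^sup>2 \<le> (2 * k\<^sup>2)\<^sup>2" by (intro power_mono) auto
    also have "\<dots> = 4 * \<bar>k\<bar> powr 4" using k by (simp add: power_mult_distrib powr_numeral flip: power_mult)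
    also have "\<dots> \<le> 4 * \<bar>k\<bar> powr (\<alpha> * real n)"
    proof (intro mult_left_mono powr_mono k)
      show "4 \<le> \<alpha> * real n" using n \<alpha> by (simp add: field_simps)
    qed simp
    also have "\<dots> = 4 * (\<bar>k\<bar> powr \<alpha>) ^ n" using k by (simp add: powr_powr[symmetric] powr_realpow)
    also have "\<dots> = 4 * fact n / s ^ n * ((s * \<bar>k\<bar> powr \<alpha>) ^ n / fact n)" using s by (simp add: power_mult_distrib)
    also have "\<dots> \<le> 4 * fact n / s ^ n * exp (s * \<bar>k\<bar> powr \<alpha>)"
    proof (intro mult_left_mono)
      have "(s * \<bar>k\<bar> powr \<alpha>) ^ n / fact n \<le> (\<Sum>i\<le>n. (s * \<bar>k\<bar> powr \<alpha>) ^ i / fact i)"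
        using s by (intro member_le_sum) auto
      also have "\<dots> \<le> exp (s * \<bar>k\<bar> powr \<alpha>)"
        using s sum_le_suminf[OF summable_exp[of "s * \<bar>k\<bar> powr \<alpha>"], of "{..n}"]
        by (simp add: exp_def divide_inverse ac_simps scaleR_conv_of_real)
      finally show "(s * \<bar>k\<bar> powr \<alpha>) ^ n / fact n \<le> exp (s * \<bar>k\<bar> powr \<alpha>)" .
    qed (use s in auto)
    also have "\<dots> \<le> B * exp (s * \<bar>k\<bar> powr \<alpha>)" by (intro mult_right_mono) (auto simp: B_def)
    finally show ?thesis .
  qed
  have le: "(1 + k\<^sup>2) * exp (- (s * \<bar>k\<bar> powr \<alpha>)) \<le> B * inverse (1 + k\<^sup>2)" for k :: real
  proof -
    have "0 < 1 + k\<^sup>2" by (simp add: add_pos_nonneg)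
    then show ?thesis using B[of k] by (simp add: exp_minus field_simps power2_eq_square)
  qed
  have "integrable lborel (\<lambda>k. B * inverse (1 + k\<^sup>2))"
    using integrable_inverse_1_plus_square by (intro integrable_mult_right) (simp add: set_integrable_def)
  then show ?thesis
  proof (rule Bochner_Integration.integrable_bound)
    have "norm ((1 + k\<^sup>2) * exp (- (s * \<bar>k\<bar> powr \<alpha>))) \<le> norm (B * inverse (1 + k\<^sup>2))" for k
      using order_trans[OF le abs_ge_self, of k] by (simp add: abs_mult)
    then show "AE k in lborel. norm ((1 + k\<^sup>2) * exp (- (s * \<bar>k\<bar> powr \<alpha>))) \<le> norm (B * inverse (1 + k\<^sup>2))"
      by simp
  qed measurable
qed

context
  fixes \<psi> :: "real \<Rightarrow> complex" and \<alpha> C A :: real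
  assumes \<alpha>: "\<alpha> > 0" and C: "C > 0"
    and meas[measurable]: "\<psi> \<in> borel_measurable borel"
    and Re_le: "\<And>k. Re (\<psi> k) \<le> - C * \<bar>k\<bar> powr \<alpha>"
    and growth: "\<And>k. norm (\<psi> k) \<le> A * (1 + k\<^sup>2)"
begin

lemma norm_exp_symbol_le: "t \<ge> 0 \<Longrightarrow> norm (exp (t *\<^sub>R \<psi> k)) \<le> exp (- (t * C * \<bar>k\<bar> powr \<alpha>))"
  using mult_left_mono[OF Re_le[of k], of t] by (simp add: norm_exp_eq_Re ac_simps)

lemma integrable_quadratic_exp_symbol:
  assumes t: "t > 0"
  shows "integrable lborel (\<lambda>k. (1 + k\<^sup>2) * norm (exp (t *\<^sub>R \<psi> k)))"
  by (rule Bochner_Integration.integrable_bound[OF integrable_quadratic_exp_decay[OF \<alpha>, of "t * C"]])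
     (use t C norm_exp_symbol_le[of t] in \<open>auto intro!: AE_I2 mult_left_mono simp: abs_mult\<close>)

lemma has_vector_derivative_inv_fourier_semigroup:
  assumes t: "t > 0"
  shows "((\<lambda>s. inv_fourier (\<lambda>k. exp (s *\<^sub>R \<psi> k)) x) has_vector_derivative
      inv_fourier (\<lambda>k. \<psi> k * exp (t *\<^sub>R \<psi> k)) x) (at t)"
  unfolding inv_fourier_def
proof (rule has_vector_derivative_mult_right)
  let ?w = "\<lambda>k. A * ((1 + k\<^sup>2) * exp (- (t / 2 * C * \<bar>k\<bar> powr \<alpha>)))"
  show "((\<lambda>s. CLINT k|lborel. iexp (- (k * x)) * exp (s *\<^sub>R \<psi> k)) has_vector_derivative
      (CLINT k|lborel. iexp (- (k * x)) * (\<psi> k * exp (t *\<^sub>R \<psi> k)))) (at t)"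
  \<comment> \<open>Radius t / 2 keeps every time s above t / 2, so one decay rate dominates the
    whole ball; no such bound survives as s tends to 0.\<close>
  proof (rule has_vector_derivative_lebesgue_integral(2)[where e = "t / 2" and w = ?w
        and f' = "\<lambda>s k. iexp (- (k * x)) * (\<psi> k * exp (s *\<^sub>R \<psi> k))"])
    show "integrable lborel ?w"
      using integrable_quadratic_exp_decay[OF \<alpha>, of "t / 2 * C"] t C by (intro integrable_mult_right) simp
    fix s assume "s \<in> ball t (t / 2)"
    then have s: "t / 2 \<le> s" "0 < s" using t by (auto simp: dist_real_def abs_if split: if_splits)
    show "integrable lborel (\<lambda>k. iexp (- (k * x)) * exp (s *\<^sub>R \<psi> k))"
      by (intro inv_fourier_integrable integrable_of_quadratic integrable_quadratic_exp_symbol s) measurable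
    show "((\<lambda>s. iexp (- (k * x)) * exp (s *\<^sub>R \<psi> k)) has_vector_derivative
        iexp (- (k * x)) * (\<psi> k * exp (s *\<^sub>R \<psi> k))) (at s)" for k
      by (intro has_vector_derivative_mult_right exp_scaleR_has_vector_derivative_left)
    show "norm (iexp (- (k * x)) * (\<psi> k * exp (s *\<^sub>R \<psi> k))) \<le> ?w k" for k
    proof -
      have "norm (exp (s *\<^sub>R \<psi> k)) \<le> exp (- (s * C * \<bar>k\<bar> powr \<alpha>))" by (rule norm_exp_symbol_le) (use s in auto)
      also have "\<dots> \<le> exp (- (t / 2 * C * \<bar>k\<bar> powr \<alpha>))" 
        unfolding exp_le_cancel_iff neg_le_iff_le using s C by (intro mult_right_mono) auto
      finally have "norm (\<psi> k) * norm (exp (s *\<^sub>R \<psi> k)) \<le> A * (1 + k\<^sup>2) * exp (- (t / 2 * C * \<bar>k\<bar> powr \<alpha>))"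
        by (intro mult_mono growth order_trans[OF norm_ge_zero growth]) auto
      then show ?thesis by (simp add: norm_mult ac_simps)
    qed
  qed (use t in auto)
qed

end

section \<open>The diffusion equation\<close>

theorem theorem5p1:
  fixes c \<alpha> v D1 D2 a :: real
    and \<theta>1 \<theta>2 :: "real \<Rightarrow> real"
    and M :: "'a measure" and X :: "real \<Rightarrow> 'a \<Rightarrow> real"
    and \<phi> :: "real measure"
  assumes c: "c > 1"
    and \<alpha>: "0 < \<alpha>" "\<alpha> < 2"
    and \<theta>1: "admissable c \<alpha> \<theta>1" "\<exists>\<mu>. is_phi_measure \<alpha> \<theta>1 \<mu>"
    and \<theta>2: "admissable c \<alpha> \<theta>2" "\<exists>\<mu>. is_phi_measure \<alpha> \<theta>2 \<mu>"
    and D_nz: "D1 + D2 \<noteq> 0"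
    and D_neg: "\<alpha> < 1 \<Longrightarrow> D1 \<le> 0 \<and> D2 \<le> 0"
    and D_pos: "\<alpha> \<ge> 1 \<Longrightarrow> D1 \<ge> 0 \<and> D2 \<ge> 0"
    and \<phi>: "levy_measure \<phi>"
    and tail_pos: "\<And>r. r > 0 \<Longrightarrow>
          emeasure \<phi> {r<..} = ennreal (r powr (- \<alpha>) * \<bar>D1\<bar> * \<theta>1 (ln r))"
    and tail_neg: "\<And>r. r > 0 \<Longrightarrow>
          emeasure \<phi> {..<- r} = ennreal (r powr (- \<alpha>) * \<bar>D2\<bar> * \<theta>2 (ln r))"
    and a: "a = v +
          (if \<alpha> < 1 then LINT y:- {0}|\<phi>. y / (1 + y\<^sup>2)
           else if \<alpha> = 1 then LINT y:- {0}|\<phi>. y / (1 + y\<^sup>2) - sin y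
           else LINT y:- {0}|\<phi>. y / (1 + y\<^sup>2) - y)"
    and X: "semistable_levy_process c \<alpha> M X"
    and X1: "\<And>x. char (distr M borel (X 1)) x = exp (log_char a \<phi> x)"
  shows "\<exists>p :: real \<Rightarrow> real \<Rightarrow> real.
    (\<forall>t>0. continuous_on UNIV (\<lambda>x. p x t) \<and> (\<forall>x. p x t \<ge> 0) \<and>
       distributed M lborel (X t) (\<lambda>x. ennreal (p x t))) \<and>
    (\<forall>x. \<forall>t>0.
       (\<lambda>s. p x s) differentiable (at t) \<and>
       (\<lambda>z. p z t) differentiable (at x) \<and>
       has_semifrac_pos \<alpha> \<theta>1 (\<lambda>z. p z t) x \<and>
       has_semifrac_neg \<alpha> \<theta>2 (\<lambda>z. p z t) x \<and>
       deriv (\<lambda>s. p x s) t =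
         - v * deriv (\<lambda>z. p z t) x
         + D1 * semifrac_pos \<alpha> \<theta>1 (\<lambda>z. p z t) x
         + D2 * semifrac_neg \<alpha> \<theta>2 (\<lambda>z. p z t) x)"
proof -
  let ?\<mu> = "phi_measure \<alpha> \<theta>1" and ?\<nu> = "phi_measure \<alpha> \<theta>2"
  let ?\<psi> = "log_char a \<phi>"
  let ?S = "symbol \<alpha> ?\<mu>" and ?T = "symbol \<alpha> ?\<nu>"
  note \<mu> = is_phi_measure_phi_measure[OF \<theta>1(2)] and \<nu> = is_phi_measure_phi_measure[OF \<theta>2(2)]
  note \<mu>D = is_phi_measureD[OF \<mu>] and \<nu>D = is_phi_measureD[OF \<nu>]
  note G1 = set_integrable_kernel_bound[OF c \<alpha> \<theta>1(1) \<mu>] and G2 = set_integrable_kernel_bound[OF c \<alpha> \<theta>2(1) \<nu>]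
  have \<psi>: "?\<psi> k = \<i> * complex_of_real (v * k) + \<bar>D1\<bar> *\<^sub>R ?S k + \<bar>D2\<bar> *\<^sub>R ?T (- k)" for k
  proof (rule log_char_eq_symbol)
    show "sets \<phi> = sets borel" using \<phi> by (simp add: levy_measure_def)
    show "emeasure \<phi> {r<..} = ennreal \<bar>D1\<bar> * emeasure ?\<mu> {r<..}" if "r > 0" for r
      using tail_pos[OF that] \<mu>D(3)[OF that] by (simp add: ennreal_mult'[symmetric] ac_simps)
    show "emeasure \<phi> {..<- r} = ennreal \<bar>D2\<bar> * emeasure ?\<nu> {r<..}" if "r > 0" for r
      using tail_neg[OF that] \<nu>D(3)[OF that] by (simp add: ennreal_mult'[symmetric] ac_simps)
    show "a = v + (LINT y:- {0}|\<phi>. y / (1 + y\<^sup>2) - compensator \<alpha> y)"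
      using a by (simp add: compensator_def)
  qed (use \<mu>D \<nu>D G1 G2 in auto)
  have contS: "continuous_on UNIV ?S" "continuous_on UNIV ?T"
    using isCont_symbol[OF \<mu>D(1) G1] isCont_symbol[OF \<nu>D(1) G2]
    by (auto intro: continuous_at_imp_continuous_on)
  have contT: "continuous_on UNIV (\<lambda>k. ?T (- k))"
    by (rule continuous_on_compose2[OF contS(2)]) (auto intro: continuous_intros)
  have cont: "continuous_on UNIV ?\<psi>"
    unfolding \<psi>[abs_def] by (intro continuous_intros contS contT)
  have \<psi>m[measurable]: "?\<psi> \<in> borel_measurable borel" and [measurable]: "?S \<in> borel_measurable borel" "?T \<in> borel_measurable borel"
    using cont contS by (auto intro: borel_measurable_continuous_onI)
  define I1 where "I1 = 3 * (LINT y:{0<..}|?\<mu>. kernel_bound \<alpha> y)"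
  define I2 where "I2 = 3 * (LINT y:{0<..}|?\<nu>. kernel_bound \<alpha> y)"
  have S_le: "norm (?S k) \<le> I1 * (1 + k\<^sup>2)" and T_le: "norm (?T (- k)) \<le> I2 * (1 + k\<^sup>2)" for k
    using norm_symbol_le[OF \<mu>D(1) G1, of k] norm_symbol_le[OF \<nu>D(1) G2, of "- k"] by (auto simp: I1_def I2_def)
  define A where "A = \<bar>v\<bar> + \<bar>D1\<bar> * I1 + \<bar>D2\<bar> * I2"
  have growth: "norm (?\<psi> k) \<le> A * (1 + k\<^sup>2)" for k
  proof -
    have "norm (?\<psi> k) \<le> norm (\<i> * complex_of_real (v * k)) + norm (\<bar>D1\<bar> *\<^sub>R ?S k) + norm (\<bar>D2\<bar> *\<^sub>R ?T (- k))"
      unfolding \<psi> by (intro order_trans[OF norm_triangle_ineq add_right_mono] norm_triangle_ineq)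
    also have "\<dots> = \<bar>v\<bar> * \<bar>k\<bar> + \<bar>D1\<bar> * norm (?S k) + \<bar>D2\<bar> * norm (?T (- k))"
      by (simp add: norm_mult abs_mult)
    also have "\<dots> \<le> \<bar>v\<bar> * (1 + k\<^sup>2) + \<bar>D1\<bar> * (I1 * (1 + k\<^sup>2)) + \<bar>D2\<bar> * (I2 * (1 + k\<^sup>2))"
      by (intro add_mono mult_left_mono abs_le_one_plus_square S_le T_le) auto
    finally show ?thesis by (simp add: A_def algebra_simps)
  qed
  obtain C1 where C1: "C1 > 0" "\<And>k. Re (?S k) \<le> - C1 * \<bar>k\<bar> powr \<alpha>" using Re_symbol_le[OF c \<alpha> \<theta>1(1) \<mu>] by blast
  obtain C2 where C2: "C2 > 0" "\<And>k. Re (?T k) \<le> - C2 * \<bar>k\<bar> powr \<alpha>" using Re_symbol_le[OF c \<alpha> \<theta>2(1) \<nu>] by blast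
  \<comment> \<open>One nonzero coefficient is enough for decay: a single side of jumps already
    gives the rate \<bar>k\<bar>^\<alpha>.\<close>
  define C where "C = \<bar>D1\<bar> * C1 + \<bar>D2\<bar> * C2"
  have "D1 \<noteq> 0 \<or> D2 \<noteq> 0" using D_nz by auto
  moreover have "0 \<le> \<bar>D1\<bar> * C1" "0 \<le> \<bar>D2\<bar> * C2" "D1 \<noteq> 0 \<Longrightarrow> 0 < \<bar>D1\<bar> * C1" "D2 \<noteq> 0 \<Longrightarrow> 0 < \<bar>D2\<bar> * C2"
    using C1(1) C2(1) by auto
  ultimately have C: "C > 0" unfolding C_def by linarith
  have Re_le: "Re (?\<psi> k) \<le> - C * \<bar>k\<bar> powr \<alpha>" for k
  proof -
    have "Re (?\<psi> k) = \<bar>D1\<bar> * Re (?S k) + \<bar>D2\<bar> * Re (?T (- k))" by (simp add: \<psi>)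
    also have "\<dots> \<le> \<bar>D1\<bar> * (- C1 * \<bar>k\<bar> powr \<alpha>) + \<bar>D2\<bar> * (- C2 * \<bar>- k\<bar> powr \<alpha>)"
      by (intro add_mono mult_left_mono C1 C2) auto
    finally show ?thesis by (simp add: C_def algebra_simps)
  qed
  have Re_mult: "Re (complex_of_real r * z) = r * Re z" for r z by simp
  have L: "levy_process M X" using X by (simp add: semistable_levy_process_def)
  let ?g = "\<lambda>t k. exp (t *\<^sub>R ?\<psi> k)"
  define p where "p x t = Re (inv_fourier (?g t) x)" for x t
  have gm: "?g t \<in> borel_measurable borel" for t by measurable
  have g2: "integrable lborel (\<lambda>k. (1 + k\<^sup>2) * norm (?g t k))" if "t > 0" for t
    by (rule integrable_quadratic_exp_symbol[OF \<alpha>(1) C \<psi>m Re_le growth that])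
  show ?thesis
  proof (intro exI[of _ p] conjI allI impI)
    fix t :: real assume t: "t > 0"
    note int = integrable_of_quadratic[OF gm g2[OF t]]
    show "continuous_on UNIV (\<lambda>x. p x t)"
      unfolding p_def using isCont_inv_fourier[OF int]
      by (auto intro!: continuous_at_imp_continuous_on continuous_intros)
    interpret N: real_distribution "distr M borel (X t)"
      by (rule levy_process_real_distribution[OF L]) (use t in simp)
    have ch: "char (distr M borel (X t)) = ?g t"
      by (rule ext, rule char_levy_process[OF L X1 cont]) (use t in \<open>auto simp: \<psi>\<close>)
    note dens = N.inv_fourier_char_density[unfolded ch, OF int]
    show "p x t \<ge> 0" for x unfolding p_def by (rule dens(1))
    have "distr M lborel (X t) = distr M borel (X t)" by (rule distr_cong) auto
    moreover have "X t \<in> borel_measurable M" by (rule levy_process_measurable[OF L]) (use t in simp)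
    moreover have "(\<lambda>x. p x t) \<in> borel_measurable borel"
      using \<open>continuous_on UNIV (\<lambda>x. p x t)\<close> by (rule borel_measurable_continuous_onI)
    ultimately show "distributed M lborel (X t) (\<lambda>x. ennreal (p x t))"
      using dens(2) by (simp add: distributed_def p_def)
  next
    fix x t :: real assume t: "t > 0"
    note Q = gm[of t] g2[OF t]
    let ?u' = "Re (inv_fourier (\<lambda>k. - \<i> * k * ?g t k) x)"
    have dt: "((\<lambda>s. p x s) has_real_derivative Re (inv_fourier (\<lambda>k. ?\<psi> k * ?g t k) x)) (at t)"
      unfolding p_def
      by (rule has_field_derivative_Re[OF has_vector_derivative_inv_fourier_semigroup[OF \<alpha>(1) C \<psi>m Re_le growth t]])
    then show "(\<lambda>s. p x s) differentiable (at t)" using real_differentiable_def by blast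
    have dx: "((\<lambda>z. p z t) has_real_derivative ?u') (at x)"
      unfolding p_def by (rule has_real_derivative_Re_inv_fourier[OF Q])
    then show "(\<lambda>z. p z t) differentiable (at x)" using real_differentiable_def by blast
    note SP = semifrac_inv_fourier[OF Q sigma_finite_is_phi_measure[OF \<mu>] \<mu>D(1) G1, of x]
      and SN = semifrac_inv_fourier[OF Q sigma_finite_is_phi_measure[OF \<nu>] \<nu>D(1) G2, of x]
    show "has_semifrac_pos \<alpha> \<theta>1 (\<lambda>z. p z t) x" unfolding p_def by (rule SP(1))
    show "has_semifrac_neg \<alpha> \<theta>2 (\<lambda>z. p z t) x" unfolding p_def by (rule SN(2))
    have i1: "integrable lborel (\<lambda>k. complex_of_real (- v) * (- \<i> * complex_of_real k * ?g t k))"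
      by (intro integrable_mult_right integrable_mult_quadratic[OF Q, where K = 1])
         (auto simp: norm_mult abs_le_one_plus_square)
    have i2: "integrable lborel (\<lambda>k. complex_of_real \<bar>D1\<bar> * (?S k * ?g t k))"
      by (intro integrable_mult_right integrable_mult_quadratic[OF Q, where K = I1] S_le) measurable
    have i3: "integrable lborel (\<lambda>k. complex_of_real \<bar>D2\<bar> * (?T (- k) * ?g t k))"
      by (intro integrable_mult_right integrable_mult_quadratic[OF Q, where K = I2] T_le) measurable
    \<comment> \<open>The exponent is regrouped into multipliers of known operators; the drift part
      is \<i> v k = (- v) (- \<i> k), which is - v times the derivative in x.\<close>
    have "inv_fourier (\<lambda>k. ?\<psi> k * ?g t k) x = inv_fourier (\<lambda>k. (complex_of_real (- v) * (- \<i> * complex_of_real k * ?g t k)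
        + complex_of_real \<bar>D1\<bar> * (?S k * ?g t k)) + complex_of_real \<bar>D2\<bar> * (?T (- k) * ?g t k)) x"
      by (intro arg_cong[where f = "\<lambda>h. inv_fourier h x"] ext)
         (simp add: \<psi> distrib_right scaleR_conv_of_real mult.assoc mult.left_commute)
    also have "\<dots> = complex_of_real (- v) * inv_fourier (\<lambda>k. - \<i> * complex_of_real k * ?g t k) x
        + complex_of_real \<bar>D1\<bar> * inv_fourier (\<lambda>k. ?S k * ?g t k) x + complex_of_real \<bar>D2\<bar> * inv_fourier (\<lambda>k. ?T (- k) * ?g t k) x"
      by (simp only: inv_fourier_add[OF Bochner_Integration.integrable_add[OF i1 i2] i3] inv_fourier_add[OF i1 i2] inv_fourier_mult)
    finally have "Re (inv_fourier (\<lambda>k. ?\<psi> k * ?g t k) x) = - v * ?u'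
        + \<bar>D1\<bar> * Re (inv_fourier (\<lambda>k. ?S k * ?g t k) x) + \<bar>D2\<bar> * Re (inv_fourier (\<lambda>k. ?T (- k) * ?g t k) x)"
      by (simp only: plus_complex.sel Re_mult)
    \<comment> \<open>The sign conditions on \<open>D1\<close> and \<open>D2\<close> match the
      reversed order of subtraction for \<alpha> < 1, so the positive weights of the Levy measure
      become the signed coefficients of the equation.\<close>
    moreover have "\<bar>D1\<bar> = D1 * (if \<alpha> < 1 then - 1 else 1)" "\<bar>D2\<bar> = D2 * (if \<alpha> < 1 then - 1 else 1)"
      using D_neg D_pos by auto
    ultimately show "deriv (\<lambda>s. p x s) t = - v * deriv (\<lambda>z. p z t) x
         + D1 * semifrac_pos \<alpha> \<theta>1 (\<lambda>z. p z t) x + D2 * semifrac_neg \<alpha> \<theta>2 (\<lambda>z. p z t) x"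
      unfolding DERIV_imp_deriv[OF dt] DERIV_imp_deriv[OF dx] SP(3)[folded p_def] SN(4)[folded p_def]
      by (simp only: mult.assoc)
  qed
qed

end
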